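(* Let $(X,\mu,T)$ be an ergodic measure-preserving transformation of a standard probability space, with positive (Kolmogorov–Sinai) entropy. Fix $m$ with $2\le m\le\aleph_0$. Then, in the Polish space of all measurable partitions $\mathcal P$ of $X$ into at most $m$ elements (endowed with the Rokhlin metric), there is a dense $G_\delta$ subset such that for every partition $\mathcal P$ in this subset the process generated by $\mathcal P$ (under $T$) reveals strong attracting.
   Context: Here $m$ is either a finite integer $\ge 2$ or the countable cardinal $\aleph_0$. Partitions are considered up to $\mu$-null sets. The metric on the space of measurable partitions of $X$ into at most $m$ elements is $d(\mathcal P,\mathcal Q)=\inf\sum_i\mu(P_i\triangle Q_i)$, where the infimum is over all enumerations $(P_i)$, $(Q_i)$ of the elements of $\mathcal P$ and $\mathcal Q$ by an index set of cardinality $m$ (padding with empty sets if necessary). For a partition $\mathcal P$ of $X$, let $\mathcal P^n=\bigvee_{i=0}^{n-1}T^{-i}(\mathcal P)$; its elements are called blocks (or cylinders) of length $n$ of the process generated by $\mathcal P$. For a set $B$ with $\mu(B)>0$ let $V_B(x)=\min\{i>0:T^i(x)\in B\}$ (defined for $\mu$-almost every $x\in X$), let $\overline V_B=\mu(B)V_B$, and let $F_B(t)=\mu\{\overline V_B\le t\}$ be the distribution function of the normalized hitting time. The process generated by $\mathcal P$ reveals strong attracting if there exist a subset $\mathbb N'\subset\mathbb N$ of upper density $1$ and, for each $n'\in\mathbb N'$, a collection $\mathcal B_{n'}\subset\mathcal P^{n'}$ (consisting of blocks of positive measure), such that $\mu(\bigcup\mathcal B_{n'})\to1$ as $n'\to\infty$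 in $\mathbb N'$, and such that for every choice of blocks $B_{n'}\in\mathcal B_{n'}$ ($n'\in\mathbb N'$) we have $F_{B_{n'}}(t)\to0$ as $n'\to\infty$ for each $t\ge 0$. The upper density of $\mathbb N'$ is $\limsup_{n\to\infty}\frac1n\#(\mathbb N'\cap[1,n])$. *)

theory Defs
  imports "HOL-Probability.Probability"
begin

definition iso_mod_null :: "'a measure \<Rightarrow> 'b measure \<Rightarrow> bool" where
  "iso_mod_null M N \<longleftrightarrow>
     (\<exists>X\<in>sets M. \<exists>Y\<in>sets N. \<exists>f.
        space M - X \<in> null_sets M \<and> space N - Y \<in> null_sets N \<and>
        bij_betw f X Y \<and>
        f \<in> restrict_space M X \<rightarrow>\<^sub>M restrict_space N Y \<and>
        inv_into X f \<in> restrict_space N Y \<rightarrow>\<^sub>M restrict_space M X \<and>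
        distr (restrict_space M X) (restrict_space N Y) f = restrict_space N Y)"

text \<open>
  Rokhlin's definition: after completion, the space is isomorphic modulo null sets to the real line
  with (the completion of) some Borel probability measure.  Taking the completion of \<open>M\<close> covers both
  usual conventions, namely complete spaces and Borel spaces.
\<close>

definition standard_prob_space :: "'a measure \<Rightarrow> bool" where
  "standard_prob_space M \<longleftrightarrow> prob_space M \<and>
     (\<exists>N :: real measure. prob_space N \<and> sets N = sets borel \<and>
        iso_mod_null (completion M) (completion N))"

definition measure_preserving :: "'a measure \<Rightarrow> ('a \<Rightarrow> 'a) \<Rightarrow> bool" where
  "measure_preserving M T \<longleftrightarrow> T \<in> M \<rightarrow>\<^sub>M M \<and> distr M M T = M"

definition ergodic :: "'a measure \<Rightarrow> ('a \<Rightarrow> 'a) \<Rightarrow> bool" where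
  "ergodic M T \<longleftrightarrow> measure_preserving M T \<and>
     (\<forall>A\<in>sets M. T -` A \<inter> space M = A \<longrightarrow> measure M A = 0 \<or> measure M A = 1)"

definition measurable_partition :: "'a measure \<Rightarrow> 'a set set \<Rightarrow> bool" where
  "measurable_partition M P \<longleftrightarrow> partition_on (space M) P \<and> P \<subseteq> sets M"

text \<open>The elements of \<open>P \<or> T\<^sup>-\<^sup>1 P \<or> \<dots> \<or> T\<^sup>-\<^sup>(\<^sup>n\<^sup>-\<^sup>1\<^sup>) P\<close>.\<close>

definition blocks :: "'a measure \<Rightarrow> ('a \<Rightarrow> 'a) \<Rightarrow> 'a set set \<Rightarrow> nat \<Rightarrow> 'a set set" where
  "blocks M T P n =
     {{x \<in> space M. \<forall>i<n. (T ^^ i) x \<in> s i} | s. \<forall>i<n. s i \<in> P} - {{}}"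

definition partition_entropy :: "'a measure \<Rightarrow> 'a set set \<Rightarrow> real" where
  "partition_entropy M P = - (\<Sum>A\<in>P. measure M A * ln (measure M A))"

definition entropy_wrt :: "'a measure \<Rightarrow> ('a \<Rightarrow> 'a) \<Rightarrow> 'a set set \<Rightarrow> real" where
  "entropy_wrt M T P = lim (\<lambda>n. partition_entropy M (blocks M T P n) / real n)"

definition KS_entropy :: "'a measure \<Rightarrow> ('a \<Rightarrow> 'a) \<Rightarrow> ereal" where
  "KS_entropy M T =
     (SUP P\<in>{P. measurable_partition M P \<and> finite P}. ereal (entropy_wrt M T P))"

definition hitting_time :: "('a \<Rightarrow> 'a) \<Rightarrow> 'a set \<Rightarrow> 'a \<Rightarrow> enat" where
  "hitting_time T B x = (INF i\<in>{i. 0 < i \<and> (T ^^ i) x \<in> B}. enat i)"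

definition hitting_distr :: "'a measure \<Rightarrow> ('a \<Rightarrow> 'a) \<Rightarrow> 'a set \<Rightarrow> real \<Rightarrow> real" where
  "hitting_distr M T B t =
     measure M {x \<in> space M. ereal (measure M B) * ereal_of_enat (hitting_time T B x) \<le> ereal t}"

definition upper_density :: "nat set \<Rightarrow> ereal" where
  "upper_density N = limsup (\<lambda>n. ereal (real (card (N \<inter> {1..n})) / real n))"

text \<open>
  The filter \<open>inf sequentially (principal N)\<close> expresses \<open>n \<rightarrow> \<infinity>\<close> along \<open>N\<close>.  The families \<open>\<B> n\<close> are
  required to be nonempty, since otherwise there would be no choice of blocks \<open>B n \<in> \<B> n\<close> and the
  last condition would hold vacuously.
\<close>

definition strong_attracting :: "'a measure \<Rightarrow> ('a \<Rightarrow> 'a) \<Rightarrow> 'a set set \<Rightarrow> bool" where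
  "strong_attracting M T P \<longleftrightarrow>
     (\<exists>N \<B>. N \<subseteq> {1..} \<and> upper_density N = 1 \<and>
        (\<forall>n\<in>N. \<B> n \<noteq> {} \<and> \<B> n \<subseteq> {B \<in> blocks M T P n. measure M B > 0}) \<and>
        ((\<lambda>n. measure M (\<Union>(\<B> n))) \<longlongrightarrow> 1) (inf sequentially (principal N)) \<and>
        (\<forall>B. (\<forall>n\<in>N. B n \<in> \<B> n) \<longrightarrow>
           (\<forall>t\<ge>0. ((\<lambda>n. hitting_distr M T (B n) t) \<longlongrightarrow> 0) (inf sequentially (principal N)))))"

text \<open>
  The bound \<open>m\<close> on the number of elements is an \<open>enat\<close>, where \<open>\<infinity>\<close> stands for the countable cardinal;
  the following is an index set of cardinality \<open>m\<close>.
\<close>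

definition index_set :: "enat \<Rightarrow> nat set" where
  "index_set m = {i. enat i < m}"

definition partitions :: "'a measure \<Rightarrow> enat \<Rightarrow> 'a set set set" where
  "partitions M m = {P. measurable_partition M P \<and> P \<lesssim> index_set m}"

definition partition_rel :: "'a measure \<Rightarrow> enat \<Rightarrow> ('a set set \<times> 'a set set) set" where
  "partition_rel M m = {(P, Q). P \<in> partitions M m \<and> Q \<in> partitions M m \<and>
     (\<forall>A\<in>P. measure M A > 0 \<longrightarrow> (\<exists>B\<in>Q. measure M (sym_diff A B) = 0)) \<and>
     (\<forall>B\<in>Q. measure M B > 0 \<longrightarrow> (\<exists>A\<in>P. measure M (sym_diff A B) = 0))}"

definition partition_space :: "'a measure \<Rightarrow> enat \<Rightarrow> 'a set set set set" where
  "partition_space M m = partitions M m // partition_rel M m"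

text \<open>
  Classes modulo null sets, with the Rokhlin metric taken over all representatives; by
  \<open>Metric_space_partitions\<close> below this is a genuine metric on \<open>partition_space M m\<close>.
  An enumeration lists every element of \<open>P\<close> exactly once; all other entries are empty.
\<close>

definition enumerates :: "nat set \<Rightarrow> (nat \<Rightarrow> 'a set) \<Rightarrow> 'a set set \<Rightarrow> bool" where
  "enumerates I e P \<longleftrightarrow> bij_betw e {i\<in>I. e i \<noteq> {}} P"

definition partition_dist ::
    "'a measure \<Rightarrow> enat \<Rightarrow> 'a set set set \<Rightarrow> 'a set set set \<Rightarrow> real" where
  "partition_dist M m C D =
     enn2real (Inf {\<Sum>\<^sub>\<infinity>i\<in>index_set m. emeasure M (sym_diff (e i) (f i)) | e f P Q.
       P \<in> C \<and> Q \<in> D \<and> enumerates (index_set m) e P \<and> enumerates (index_set m) f Q})"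

abbreviation partition_topology :: "'a measure \<Rightarrow> enat \<Rightarrow> 'a set set set topology" where
  "partition_topology M m \<equiv> Metric_space.mtopology (partition_space M m) (partition_dist M m)"

lemma enumerates_exists:
  assumes "P \<lesssim> I" "{} \<notin> P"
  shows "\<exists>e. enumerates I e P"
proof -
  obtain h where h: "inj_on h P" "h ` P \<subseteq> I" using assms(1) by (auto simp: lepoll_def)
  define e where "e = (\<lambda>i. if i \<in> h ` P then inv_into P h i else {})"
  have "e i \<in> P" if "i \<in> h ` P" for i using that by (simp add: e_def inv_into_into)
  then have eq: "{i\<in>I. e i \<noteq> {}} = h ` P" using h assms(2) by (force simp: e_def)
  have "bij_betw (inv_into P h) (h ` P) P" using h by (simp add: bij_betw_inv_into inj_on_imp_bij_betw)
  then have "bij_betw e (h ` P) P" by (subst bij_betw_cong[where g = "inv_into P h"]) (auto simp: e_def)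
  then show ?thesis unfolding enumerates_def using eq by metis
qed

lemma enumerates_permute:
  assumes "enumerates I e P" "bij_betw p I I"
  shows "enumerates I (e \<circ> p) P"
proof -
  have "bij_betw p {i\<in>I. e (p i) \<noteq> {}} {i\<in>I. e i \<noteq> {}}"
    unfolding bij_betw_def
  proof
    show "inj_on p {i\<in>I. e (p i) \<noteq> {}}"
      using assms(2) by (auto simp: bij_betw_def intro: inj_on_subset)
    have "p ` I = I" using assms(2) by (simp add: bij_betw_def)
    have "j \<in> p ` {i\<in>I. e (p i) \<noteq> {}}" if "j \<in> I" "e j \<noteq> {}" for j
    proof -
      have "j \<in> p ` I" using that(1) by (simp only: \<open>p ` I = I\<close>)
      then obtain i where i: "j = p i" "i \<in> I" by (rule imageE)
      show ?thesis using i that(2) by (intro image_eqI[where f = p and x = i]) simp_all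
    qed
    moreover have "p i \<in> I" if "i \<in> I" for i using imageI[OF that, of p] by (simp only: \<open>p ` I = I\<close>)
    ultimately show "p ` {i\<in>I. e (p i) \<noteq> {}} = {i\<in>I. e i \<noteq> {}}" by fastforce
  qed
  from bij_betw_trans[OF this assms(1)[unfolded enumerates_def]]
  show ?thesis by (simp add: enumerates_def)
qed

lemma enumerates_cases:
  assumes "enumerates I e P" "i \<in> I"
  shows "e i = {} \<or> e i \<in> P"
  using assms unfolding enumerates_def bij_betw_def by auto

lemma enumerates_obtain:
  assumes "enumerates I e P" "A \<in> P"
  obtains i where "i \<in> I" "e i = A"
  using assms unfolding enumerates_def bij_betw_def by auto

lemma enumerates_inj:
  assumes "enumerates I e P" "i \<in> I" "j \<in> I" "e i = e j" "e i \<noteq> {}"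
  shows "i = j"
  using assms unfolding enumerates_def bij_betw_def inj_on_def by auto

lemma extend_to_permutation:
  fixes I F :: "nat set"
  assumes "finite F" "F \<subseteq> I" "inj_on p F" "p ` F \<subseteq> I"
  shows "\<exists>q. bij_betw q I I \<and> (\<forall>i\<in>F. q i = p i)"
proof -
  have "\<exists>r. bij_betw r (I - F) (I - p ` F)"
  proof (cases "finite I")
    case True
    have "card (I - F) = card (I - p ` F)"
      using assms True by (simp add: card_Diff_subset card_image finite_subset)
    then show ?thesis using True by (intro finite_same_card_bij) auto
  next
    case False
    then have "infinite (I - F)" "infinite (I - p ` F)" using assms by auto
    then have "bij_betw (from_nat_into (I - p ` F) \<circ> to_nat_on (I - F)) (I - F) (I - p ` F)"
      by (intro bij_betw_trans[OF to_nat_on_infinite bij_betw_from_nat_into]) auto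
    then show ?thesis by blast
  qed
  then obtain r where r: "bij_betw r (I - F) (I - p ` F)" by blast
  define q where "q = (\<lambda>i. if i \<in> F then p i else r i)"
  have "bij_betw q F (p ` F)" using assms by (auto simp: q_def bij_betw_def inj_on_def)
  moreover have "bij_betw q (I - F) (I - p ` F)"
    using r by (subst bij_betw_cong[where g = r]) (auto simp: q_def)
  ultimately have "bij_betw q (F \<union> (I - F)) (p ` F \<union> (I - p ` F))"
    by (intro bij_betw_combine) auto
  then have "bij_betw q I I" using assms by (simp add: Un_absorb1)
  then show ?thesis by (auto simp: q_def)
qed

context prob_space
begin

lemma emeasure_sym_diff_triangle:
  assumes "A \<in> sets M" "B \<in> sets M" "C \<in> sets M"
  shows "emeasure M (sym_diff A C) \<le> emeasure M (sym_diff A B) + emeasure M (sym_diff B C)"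
proof -
  have "emeasure M (sym_diff A C) \<le> emeasure M (sym_diff A B \<union> sym_diff B C)"
    using assms by (intro emeasure_mono) auto
  also have "\<dots> \<le> emeasure M (sym_diff A B) + emeasure M (sym_diff B C)"
    using assms by (intro emeasure_subadditive) auto
  finally show ?thesis .
qed

lemma measure_sym_diff_triangle:
  assumes "A \<in> sets M" "B \<in> sets M" "C \<in> sets M"
  shows "measure M (sym_diff A C) \<le> measure M (sym_diff A B) + measure M (sym_diff B C)"
proof -
  have "measure M (sym_diff A C) \<le> measure M (sym_diff A B \<union> sym_diff B C)"
    using assms by (intro finite_measure_mono) auto
  also have "\<dots> \<le> measure M (sym_diff A B) + measure M (sym_diff B C)"
    using assms by (intro measure_Un_le) auto
  finally show ?thesis .
qed

lemma measure_le_sym_diff: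
  assumes "A \<in> sets M" "B \<in> sets M"
  shows "measure M A \<le> measure M B + measure M (sym_diff A B)"
  using measure_sym_diff_triangle[of A B "{}"] assms by (simp add: add.commute)

lemma partitions_sets: "P \<in> partitions M m \<Longrightarrow> A \<in> P \<Longrightarrow> A \<in> sets M"
  by (auto simp: partitions_def measurable_partition_def)

lemma partitions_disjoint:
  "P \<in> partitions M m \<Longrightarrow> A \<in> P \<Longrightarrow> B \<in> P \<Longrightarrow> A \<noteq> B \<Longrightarrow> A \<inter> B = {}"
  by (auto simp: partitions_def measurable_partition_def partition_on_def disjoint_def)

lemma partition_rel_obtain:
  assumes "(P, Q) \<in> partition_rel M m" "A \<in> P" "measure M A > 0"
  obtains B where "B \<in> Q" "measure M (sym_diff A B) = 0"
  using assms by (auto simp: partition_rel_def)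

lemma partition_rel_sym: "(P, Q) \<in> partition_rel M m \<Longrightarrow> (Q, P) \<in> partition_rel M m"
  by (auto simp: partition_rel_def Un_commute)

lemma partition_rel_trans_aux:
  assumes "(P, Q) \<in> partition_rel M m" "(Q, R) \<in> partition_rel M m" "A \<in> P" "measure M A > 0"
  shows "\<exists>C\<in>R. measure M (sym_diff A C) = 0"
proof -
  have PQR: "P \<in> partitions M m" "Q \<in> partitions M m" "R \<in> partitions M m"
    using assms by (auto simp: partition_rel_def)
  obtain B where B: "B \<in> Q" "measure M (sym_diff A B) = 0"
    using partition_rel_obtain assms by metis
  have sets: "A \<in> sets M" "B \<in> sets M" using B assms PQR partitions_sets by blast+
  then have "measure M B > 0" using measure_le_sym_diff[of A B] B assms(4) by simp
  then obtain C where C: "C \<in> R" "measure M (sym_diff B C) = 0"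
    using partition_rel_obtain B assms(2) by metis
  have "measure M (sym_diff A C) \<le> 0"
    using measure_sym_diff_triangle[of A B C] sets B C PQR partitions_sets by fastforce
  then show ?thesis using C measure_nonneg by (metis order_antisym)
qed

lemma equiv_partition_rel: "equiv (partitions M m) (partition_rel M m)"
proof (rule equivI)
  show "partition_rel M m \<subseteq> partitions M m \<times> partitions M m" by (auto simp: partition_rel_def)
  show "refl_on (partitions M m) (partition_rel M m)"
    by (auto simp: refl_on_def partition_rel_def intro!: bexI)
  show "sym (partition_rel M m)" using partition_rel_sym by (auto simp: sym_def)
  show "trans (partition_rel M m)"
  proof (rule transI)
    fix P Q R assume *: "(P, Q) \<in> partition_rel M m" "(Q, R) \<in> partition_rel M m"
    then have "P \<in> partitions M m" "R \<in> partitions M m" by (auto simp: partition_rel_def)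
    moreover have "\<exists>C\<in>R. measure M (sym_diff A C) = 0" if "A \<in> P" "measure M A > 0" for A
      using partition_rel_trans_aux * that by blast
    moreover have "\<exists>A\<in>P. measure M (sym_diff A C) = 0" if "C \<in> R" "measure M C > 0" for C
      using partition_rel_trans_aux[of R Q m P C] partition_rel_sym * that by (metis Un_commute)
    ultimately show "(P, R) \<in> partition_rel M m" unfolding partition_rel_def by blast
  qed
qed

lemma enumerates_sets:
  assumes "P \<in> partitions M m" "enumerates (index_set m) e P" "i \<in> index_set m"
  shows "e i \<in> sets M"
  using enumerates_cases[OF assms(2,3)] partitions_sets[OF assms(1)] by auto

lemma enumerates_sum:
  assumes "P \<in> partitions M m" "enumerates (index_set m) e P"
  shows "(\<Sum>\<^sub>\<infinity>i\<in>index_set m. emeasure M (e i)) = 1"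
proof -
  define I where "I = index_set m"
  have sets: "e i \<in> sets M" if "i \<in> I" for i using enumerates_sets assms that I_def by blast
  have disj: "disjoint_family_on e I"
    unfolding disjoint_family_on_def
    using enumerates_cases[OF assms(2)] enumerates_inj[OF assms(2)]
      partitions_disjoint[OF assms(1)] unfolding I_def by (metis inf_bot_left inf_bot_right)
  have "P \<subseteq> e ` I" using enumerates_obtain[OF assms(2)] I_def by blast
  then have "\<Union>(e ` I) = \<Union>P" using enumerates_cases[OF assms(2)] I_def by fastforce
  then have U: "\<Union>(e ` I) = space M"
    using assms(1) by (auto simp: partitions_def measurable_partition_def partition_on_def)
  define e' where "e' = (\<lambda>i. if i \<in> I then e i else {})"
  have "(\<lambda>i. emeasure M (e' i)) sums emeasure M (\<Union>(range e'))"
    using sets disj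
    by (intro sums_emeasure) (auto simp: e'_def disjoint_family_on_def)
  moreover have "\<Union>(range e') = space M" using U by (auto simp: e'_def split: if_splits)
  ultimately have "(\<lambda>i. emeasure M (e' i)) sums 1" by (simp add: emeasure_space_1)
  moreover have "(\<lambda>i. emeasure M (e' i)) sums (\<Sum>\<^sub>\<infinity>i. emeasure M (e' i))"
    by (intro has_sum_imp_sums has_sum_infsum) (simp add: nonneg_summable_on_complete)
  ultimately have "(\<Sum>\<^sub>\<infinity>i. emeasure M (e' i)) = 1" using sums_unique2 by blast
  moreover have "(\<Sum>\<^sub>\<infinity>i. emeasure M (e' i)) = (\<Sum>\<^sub>\<infinity>i\<in>I. emeasure M (e i))"
    by (intro infsum_cong_neutral) (auto simp: e'_def)
  ultimately show ?thesis by (simp add: I_def)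
qed

lemma enumerates_tail:
  assumes P: "P \<in> partitions M m" "enumerates (index_set m) e P"
    and F: "finite F" "F \<subseteq> index_set m" "1 \<le> (\<Sum>i\<in>F. emeasure M (e i)) + \<epsilon>"
  shows "(\<Sum>\<^sub>\<infinity>i\<in>index_set m. if i \<in> F then 0 else emeasure M (e i)) \<le> \<epsilon>"
proof -
  let ?I = "index_set m"
  have "(\<Sum>\<^sub>\<infinity>i\<in>F \<union> (?I - F). emeasure M (e i)) =
      (\<Sum>\<^sub>\<infinity>i\<in>F. emeasure M (e i)) + (\<Sum>\<^sub>\<infinity>i\<in>?I - F. emeasure M (e i))"
    by (intro infsum_Un_disjoint) (auto simp: nonneg_summable_on_complete)
  then have "1 = (\<Sum>i\<in>F. emeasure M (e i)) + (\<Sum>\<^sub>\<infinity>i\<in>?I - F. emeasure M (e i))"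
    using enumerates_sum[OF P] F by (simp add: Un_absorb1)
  moreover have "(\<Sum>i\<in>F. emeasure M (e i)) \<noteq> top"
    using F by (simp add: ennreal_sum_eq_top)
  ultimately have "(\<Sum>\<^sub>\<infinity>i\<in>?I - F. emeasure M (e i)) \<le> \<epsilon>"
    using F(3) ennreal_add_left_cancel_le[of "\<Sum>i\<in>F. emeasure M (e i)"
        "\<Sum>\<^sub>\<infinity>i\<in>?I - F. emeasure M (e i)" \<epsilon>]
    unfolding infinity_ennreal_def by argo
  moreover have "(\<Sum>\<^sub>\<infinity>i\<in>?I. if i \<in> F then 0 else emeasure M (e i)) = (\<Sum>\<^sub>\<infinity>i\<in>?I - F. emeasure M (e i))"
    by (intro infsum_cong_neutral) auto
  ultimately show ?thesis by simp
qed

lemma enumerates_finite_part: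
  assumes "P \<in> partitions M m" "enumerates (index_set m) e P" "\<epsilon> > 0"
  obtains F where "finite F" "F \<subseteq> index_set m" "\<And>i. i \<in> F \<Longrightarrow> measure M (e i) > 0"
    "1 \<le> (\<Sum>i\<in>F. emeasure M (e i)) + \<epsilon>"
proof -
  have "1 = (SUP F\<in>{F. finite F \<and> F \<subseteq> index_set m}. \<Sum>i\<in>F. emeasure M (e i))"
    using enumerates_sum[OF assms(1,2)] by (subst (asm) nonneg_infsum_complete) auto
  moreover have "\<exists>F. finite F \<and> F \<subseteq> index_set m \<and> 1 \<le> (\<Sum>i\<in>F. emeasure M (e i)) + \<epsilon>"
  proof (rule ccontr)
    assume neg: "\<not> ?thesis"
    have "(\<Sum>i\<in>F. emeasure M (e i)) \<le> 1 - \<epsilon>" if "finite F" "F \<subseteq> index_set m" for F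
    proof -
      have "(\<Sum>i\<in>F. emeasure M (e i)) + \<epsilon> \<le> 1"
        using neg that linorder_le_cases by blast
      then show ?thesis
        by (metis add.commute ennreal_one_less_top ennreal_le_minus_iff add_diff_eq_ennreal)
    qed
    then have "(SUP F\<in>{F. finite F \<and> F \<subseteq> index_set m}. \<Sum>i\<in>F. emeasure M (e i)) \<le> 1 - \<epsilon>"
      by (intro SUP_least) auto
    with calculation have "1 \<le> 1 - \<epsilon>" by simp
    then show False using ennreal_between[OF assms(3) zero_less_one ennreal_one_less_top] leD by blast
  qed
  then obtain F where F: "finite F" "F \<subseteq> index_set m" "1 \<le> (\<Sum>i\<in>F. emeasure M (e i)) + \<epsilon>" by blast
  let ?F = "{i\<in>F. measure M (e i) > 0}"
  have "(\<Sum>i\<in>?F. emeasure M (e i)) = (\<Sum>i\<in>F. emeasure M (e i))"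
    using F by (intro sum.mono_neutral_left) (auto simp: emeasure_eq_measure not_less measure_le_0_iff)
  then show ?thesis using F by (intro that[of ?F]) auto
qed

lemma triangle_aux:
  assumes P: "P \<in> partitions M m" "enumerates (index_set m) e P"
    and Q: "Q \<in> partitions M m" "enumerates (index_set m) f Q"
    and Q': "(Q, Q') \<in> partition_rel M m" "enumerates (index_set m) f' Q'"
    and R: "R \<in> partitions M m" "enumerates (index_set m) g R"
    and \<epsilon>: "\<epsilon> > 0"
  obtains g' where "enumerates (index_set m) g' R"
    "(\<Sum>\<^sub>\<infinity>i\<in>index_set m. emeasure M (sym_diff (e i) (g' i))) \<le>
     (\<Sum>\<^sub>\<infinity>i\<in>index_set m. emeasure M (sym_diff (e i) (f i))) +
     (\<Sum>\<^sub>\<infinity>i\<in>index_set m. emeasure M (sym_diff (f' i) (g i))) + (\<epsilon> + \<epsilon>)"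
proof -
  define I where "I = index_set m"
  have Q'': "Q' \<in> partitions M m" using Q' by (auto simp: partition_rel_def)
  obtain F where F: "finite F" "F \<subseteq> I" "\<And>i. i \<in> F \<Longrightarrow> measure M (f i) > 0"
    "1 \<le> (\<Sum>i\<in>F. emeasure M (f i)) + \<epsilon>"
    using enumerates_finite_part[OF Q \<epsilon>] I_def by metis
  have fQ: "f i \<in> Q" if "i \<in> F" for i
    using enumerates_cases[OF Q(2)] F that I_def by fastforce
  have "\<exists>j\<in>I. measure M (sym_diff (f i) (f' j)) = 0" if i: "i \<in> F" for i
  proof -
    obtain B where "B \<in> Q'" "measure M (sym_diff (f i) B) = 0"
      using partition_rel_obtain[OF Q'(1) fQ[OF i] F(3)[OF i]] .
    moreover obtain j where "j \<in> index_set m" "f' j = B"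
      using enumerates_obtain[OF Q'(2) \<open>B \<in> Q'\<close>] .
    ultimately show ?thesis by (auto simp: I_def)
  qed
  then have "\<forall>i\<in>F. \<exists>j. j \<in> I \<and> measure M (sym_diff (f i) (f' j)) = 0" by blast
  then obtain p where "\<forall>i\<in>F. p i \<in> I \<and> measure M (sym_diff (f i) (f' (p i))) = 0"
    unfolding bchoice_iff by blast
  then have p: "\<And>i. i \<in> F \<Longrightarrow> p i \<in> I"
    "\<And>i. i \<in> F \<Longrightarrow> measure M (sym_diff (f i) (f' (p i))) = 0"
    by blast+
  have S: "e i \<in> sets M" "f i \<in> sets M" "f' i \<in> sets M" "g i \<in> sets M" if "i \<in> I" for i
    using that enumerates_sets[OF P] enumerates_sets[OF Q] enumerates_sets[OF Q'' Q'(2)]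
      enumerates_sets[OF R] by (auto simp: I_def)
  have "inj_on p F"
  proof (rule inj_onI)
    fix i j assume ij: "i \<in> F" "j \<in> F" "p i = p j"
    have meas: "f i \<in> sets M" "f j \<in> sets M" "f' (p j) \<in> sets M"
      using ij F(2) S p(1) by blast+
    have "measure M (sym_diff (f i) (f j)) \<le> 0"
      using measure_sym_diff_triangle[OF meas(1,3,2)] p(2)[of i] p(2)[of j] ij
      by (simp add: Un_commute)
    moreover have "measure M (f i) \<le> measure M (sym_diff (f i) (f j))" if "f i \<noteq> f j"
      using partitions_disjoint[OF Q(1) fQ fQ that] ij meas by (intro finite_measure_mono) auto
    ultimately have "f i = f j" using F(3)[OF ij(1)] by linarith
    moreover have "f i \<noteq> {}" using F(3)[OF ij(1)] by auto
    moreover have "i \<in> index_set m" "j \<in> index_set m" using ij F(2) by (auto simp: I_def)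
    ultimately show "i = j" by (intro enumerates_inj[OF Q(2)])
  qed
  then obtain q where q: "bij_betw q I I" "\<And>i. i \<in> F \<Longrightarrow> q i = p i"
    using extend_to_permutation[of F I p] F p by blast
  have qI: "q i \<in> I" if "i \<in> I" for i by (rule bij_betwE[OF q(1), rule_format, OF that])
  have inj: "inj_on q I" using q(1) by (simp add: bij_betw_def)
  have qF: "q i \<in> q ` F \<longleftrightarrow> i \<in> F" if "i \<in> I" for i
    by (rule inj_on_image_mem_iff[OF inj that F(2)])
  have meq: "emeasure M (f i) = emeasure M (f' (q i))" if "i \<in> F" for i
  proof -
    have meas: "f i \<in> sets M" "f' (q i) \<in> sets M" using that F(2) S qI by blast+
    then show ?thesis
      using measure_le_sym_diff[OF meas] measure_le_sym_diff[OF meas(2,1)] p(2)[OF that] q(2)[OF that]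
      by (simp add: emeasure_eq_measure Un_commute)
  qed
  have "(\<Sum>j\<in>q ` F. emeasure M (f' j)) = (\<Sum>i\<in>F. emeasure M (f i))"
    using inj_on_subset[OF inj F(2)] by (simp add: sum.reindex meq)
  then have tail': "(\<Sum>\<^sub>\<infinity>i\<in>I. if i \<in> q ` F then 0 else emeasure M (f' i)) \<le> \<epsilon>"
    unfolding I_def using F qI by (intro enumerates_tail[OF Q'' Q'(2)]) (auto simp: I_def)
  have tail: "(\<Sum>\<^sub>\<infinity>i\<in>I. if i \<in> F then 0 else emeasure M (f i)) \<le> \<epsilon>"
    unfolding I_def using F I_def by (intro enumerates_tail[OF Q]) auto
  have mid: "emeasure M (sym_diff (f i) (f' (q i))) \<le>
      (if i \<in> F then 0 else emeasure M (f i)) + (if q i \<in> q ` F then 0 else emeasure M (f' (q i)))"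
    if "i \<in> I" for i
  proof (cases "i \<in> F")
    case True
    then show ?thesis using p(2)[of i] q(2)[of i] by (simp add: emeasure_eq_measure)
  next
    case False
    have "emeasure M (sym_diff (f i) (f' (q i))) \<le> emeasure M (f i \<union> f' (q i))"
      using S that qI by (intro emeasure_mono) auto
    also have "\<dots> \<le> emeasure M (f i) + emeasure M (f' (q i))"
      using S that qI by (intro emeasure_subadditive) auto
    finally show ?thesis using False qF that by simp
  qed
  have "(\<Sum>\<^sub>\<infinity>i\<in>I. emeasure M (sym_diff (e i) (g (q i)))) \<le>
    (\<Sum>\<^sub>\<infinity>i\<in>I. (emeasure M (sym_diff (e i) (f i)) + emeasure M (sym_diff (f' (q i)) (g (q i)))) +
      ((if i \<in> F then 0 else emeasure M (f i)) + (if q i \<in> q ` F then 0 else emeasure M (f' (q i)))))"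
  proof (rule infsum_mono)
    fix i assume i: "i \<in> I"
    have "emeasure M (sym_diff (e i) (g (q i))) \<le>
        emeasure M (sym_diff (e i) (f i)) + emeasure M (sym_diff (f i) (g (q i)))"
      using S i qI by (intro emeasure_sym_diff_triangle) auto
    also have "\<dots> \<le> emeasure M (sym_diff (e i) (f i)) +
        (emeasure M (sym_diff (f i) (f' (q i))) + emeasure M (sym_diff (f' (q i)) (g (q i))))"
      using S i qI by (intro add_left_mono emeasure_sym_diff_triangle) auto
    also have "\<dots> = (emeasure M (sym_diff (e i) (f i)) + emeasure M (sym_diff (f' (q i)) (g (q i)))) +
        emeasure M (sym_diff (f i) (f' (q i)))" by (simp add: ac_simps)
    also have "\<dots> \<le> (emeasure M (sym_diff (e i) (f i)) + emeasure M (sym_diff (f' (q i)) (g (q i)))) +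
        ((if i \<in> F then 0 else emeasure M (f i)) + (if q i \<in> q ` F then 0 else emeasure M (f' (q i))))"
      by (intro add_left_mono mid i)
    finally show "emeasure M (sym_diff (e i) (g (q i))) \<le> \<dots>" .
  qed (auto simp: nonneg_summable_on_complete)
  also have "\<dots> = ((\<Sum>\<^sub>\<infinity>i\<in>I. emeasure M (sym_diff (e i) (f i))) +
        (\<Sum>\<^sub>\<infinity>i\<in>I. emeasure M (sym_diff (f' (q i)) (g (q i))))) +
      ((\<Sum>\<^sub>\<infinity>i\<in>I. if i \<in> F then 0 else emeasure M (f i)) +
        (\<Sum>\<^sub>\<infinity>i\<in>I. if q i \<in> q ` F then 0 else emeasure M (f' (q i))))"
    by (simp add: infsum_add nonneg_summable_on_complete)
  also have "(\<Sum>\<^sub>\<infinity>i\<in>I. emeasure M (sym_diff (f' (q i)) (g (q i)))) =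
      (\<Sum>\<^sub>\<infinity>i\<in>I. emeasure M (sym_diff (f' i) (g i)))"
    by (rule infsum_reindex_bij_betw[OF q(1)])
  also have "(\<Sum>\<^sub>\<infinity>i\<in>I. if q i \<in> q ` F then 0 else emeasure M (f' (q i))) =
      (\<Sum>\<^sub>\<infinity>i\<in>I. if i \<in> q ` F then 0 else emeasure M (f' i))"
    by (rule infsum_reindex_bij_betw[OF q(1)])
  also have "(\<Sum>\<^sub>\<infinity>i\<in>I. emeasure M (sym_diff (e i) (f i))) +
        (\<Sum>\<^sub>\<infinity>i\<in>I. emeasure M (sym_diff (f' i) (g i))) +
      ((\<Sum>\<^sub>\<infinity>i\<in>I. if i \<in> F then 0 else emeasure M (f i)) +
        (\<Sum>\<^sub>\<infinity>i\<in>I. if i \<in> q ` F then 0 else emeasure M (f' i))) \<le>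
      (\<Sum>\<^sub>\<infinity>i\<in>I. emeasure M (sym_diff (e i) (f i))) +
        (\<Sum>\<^sub>\<infinity>i\<in>I. emeasure M (sym_diff (f' i) (g i))) + (\<epsilon> + \<epsilon>)"
    by (intro add_left_mono add_mono tail tail')
  finally have "(\<Sum>\<^sub>\<infinity>i\<in>I. emeasure M (sym_diff (e i) ((g \<circ> q) i))) \<le>
      (\<Sum>\<^sub>\<infinity>i\<in>I. emeasure M (sym_diff (e i) (f i))) +
        (\<Sum>\<^sub>\<infinity>i\<in>I. emeasure M (sym_diff (f' i) (g i))) + (\<epsilon> + \<epsilon>)" by simp
  moreover have "enumerates (index_set m) (g \<circ> q) R"
    using enumerates_permute[OF R(2)] q(1) I_def by simp
  ultimately show ?thesis using that I_def by simp
qed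

definition partition_costs :: "enat \<Rightarrow> 'a set set set \<Rightarrow> 'a set set set \<Rightarrow> ennreal set" where
  "partition_costs m C D = {\<Sum>\<^sub>\<infinity>i\<in>index_set m. emeasure M (sym_diff (e i) (f i)) | e f P Q.
     P \<in> C \<and> Q \<in> D \<and> enumerates (index_set m) e P \<and> enumerates (index_set m) f Q}"

lemma partition_dist_costs: "partition_dist M m C D = enn2real (Inf (partition_costs m C D))"
  by (simp add: partition_dist_def partition_costs_def)

lemma partition_costs_commute: "partition_costs m C D = partition_costs m D C"
  unfolding partition_costs_def by (subst Un_commute) blast

lemma partition_space_subset: "C \<in> partition_space M m \<Longrightarrow> P \<in> C \<Longrightarrow> P \<in> partitions M m"
  using equiv_partition_rel[of m] unfolding partition_space_def
  by (meson in_quotient_imp_subset subsetD)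

lemma partition_space_obtain:
  assumes "C \<in> partition_space M m"
  obtains P e where "P \<in> C" "P \<in> partitions M m" "enumerates (index_set m) e P"
proof -
  obtain P where P: "P \<in> C" using in_quotient_imp_non_empty[OF equiv_partition_rel] assms
    unfolding partition_space_def by blast
  then have P': "P \<in> partitions M m" using assms partition_space_subset by blast
  then have "P \<lesssim> index_set m" "{} \<notin> P"
    by (auto simp: partitions_def measurable_partition_def partition_on_def)
  then show ?thesis using that P P' enumerates_exists by metis
qed

lemma partition_space_rel:
  assumes "C \<in> partition_space M m" "P \<in> C" "Q \<in> C"
  shows "(P, Q) \<in> partition_rel M m"
  using in_quotient_imp_in_rel[OF equiv_partition_rel] assms unfolding partition_space_def by blast

lemma Inf_partition_costs_finite:
  assumes "C \<in> partition_space M m" "D \<in> partition_space M m"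
  shows "Inf (partition_costs m C D) < top"
proof -
  obtain P e where P: "P \<in> C" "P \<in> partitions M m" "enumerates (index_set m) e P"
    using partition_space_obtain assms by blast
  obtain Q f where Q: "Q \<in> D" "Q \<in> partitions M m" "enumerates (index_set m) f Q"
    using partition_space_obtain assms by blast
  have "Inf (partition_costs m C D) \<le> (\<Sum>\<^sub>\<infinity>i\<in>index_set m. emeasure M (sym_diff (e i) (f i)))"
    using P Q by (intro Inf_lower) (auto simp: partition_costs_def)
  also have "\<dots> \<le> (\<Sum>\<^sub>\<infinity>i\<in>index_set m. emeasure M (e i) + emeasure M (f i))"
  proof (rule infsum_mono)
    fix i assume "i \<in> index_set m"
    then have "e i \<in> sets M" "f i \<in> sets M" using enumerates_sets P Q by blast+
    then show "emeasure M (sym_diff (e i) (f i)) \<le> emeasure M (e i) + emeasure M (f i)"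
      using emeasure_sym_diff_triangle[of "e i" "{}" "f i"] by simp
  qed (auto simp: nonneg_summable_on_complete)
  also have "\<dots> = 1 + 1"
    using P Q by (simp add: infsum_add nonneg_summable_on_complete enumerates_sum)
  also have "\<dots> < top" by (simp add: less_top)
  finally show ?thesis .
qed

lemma Inf_partition_costs_triangle:
  assumes "C \<in> partition_space M m" "D \<in> partition_space M m" "E \<in> partition_space M m"
  shows "Inf (partition_costs m C E) \<le> Inf (partition_costs m C D) + Inf (partition_costs m D E)"
proof (rule ennreal_le_epsilon)
  fix \<epsilon> :: real assume "0 < \<epsilon>"
  define \<delta> where "\<delta> = ennreal (\<epsilon> / 4)"
  have \<delta>: "\<delta> > 0" using \<open>0 < \<epsilon>\<close> by (simp add: \<delta>_def)
  have \<delta>4: "(\<delta> + \<delta>) + (\<delta> + \<delta>) = ennreal \<epsilon>"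
    using \<open>0 < \<epsilon>\<close> by (simp add: \<delta>_def flip: ennreal_plus)
  have "Inf (partition_costs m C D) < Inf (partition_costs m C D) + \<delta>"
    "Inf (partition_costs m D E) < Inf (partition_costs m D E) + \<delta>"
    using ennreal_add_left_cancel_less[of "Inf (partition_costs m C D)" 0 \<delta>]
      ennreal_add_left_cancel_less[of "Inf (partition_costs m D E)" 0 \<delta>]
      less_imp_neq[OF Inf_partition_costs_finite[OF assms(1,2)]]
      less_imp_neq[OF Inf_partition_costs_finite[OF assms(2,3)]] \<delta>
    unfolding infinity_ennreal_def add_0_right by blast+
  then obtain c1 c2 where c: "c1 \<in> partition_costs m C D" "c2 \<in> partition_costs m D E"
    "c1 < Inf (partition_costs m C D) + \<delta>" "c2 < Inf (partition_costs m D E) + \<delta>"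
    unfolding Inf_less_iff by blast
  from c(1) obtain e f P Q where 1: "P \<in> C" "Q \<in> D" "enumerates (index_set m) e P"
      "enumerates (index_set m) f Q"
      "c1 = (\<Sum>\<^sub>\<infinity>i\<in>index_set m. emeasure M (sym_diff (e i) (f i)))"
    by (auto simp: partition_costs_def)
  from c(2) obtain f' g Q' R where 2: "Q' \<in> D" "R \<in> E" "enumerates (index_set m) f' Q'"
      "enumerates (index_set m) g R"
      "c2 = (\<Sum>\<^sub>\<infinity>i\<in>index_set m. emeasure M (sym_diff (f' i) (g i)))"
    by (auto simp: partition_costs_def)
  obtain g' where g': "enumerates (index_set m) g' R"
    "(\<Sum>\<^sub>\<infinity>i\<in>index_set m. emeasure M (sym_diff (e i) (g' i))) \<le> c1 + c2 + (\<delta> + \<delta>)"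
    using triangle_aux[OF partition_space_subset[OF assms(1) 1(1)] 1(3)
        partition_space_subset[OF assms(2) 1(2)] 1(4) partition_space_rel[OF assms(2) 1(2) 2(1)] 2(3)
        partition_space_subset[OF assms(3) 2(2)] 2(4) \<delta>]
    unfolding 1(5) 2(5) by blast
  have "Inf (partition_costs m C E) \<le> (\<Sum>\<^sub>\<infinity>i\<in>index_set m. emeasure M (sym_diff (e i) (g' i)))"
    using 1(1) 2(2) 1(3) g'(1) by (intro Inf_lower) (unfold partition_costs_def, blast)
  also note g'(2)
  also have "c1 + c2 + (\<delta> + \<delta>) \<le> (Inf (partition_costs m C D) + \<delta>) +
      (Inf (partition_costs m D E) + \<delta>) + (\<delta> + \<delta>)"
    using c by (intro add_mono order_refl less_imp_le) auto
  also have "\<dots> = Inf (partition_costs m C D) + Inf (partition_costs m D E) + ((\<delta> + \<delta>) + (\<delta> + \<delta>))"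
    by (simp add: ac_simps)
  finally show "Inf (partition_costs m C E) \<le>
      Inf (partition_costs m C D) + Inf (partition_costs m D E) + ennreal \<epsilon>"
    by (simp only: \<delta>4)
qed

lemma partition_costs_zero_aux:
  assumes "C \<in> partition_space M m" "D \<in> partition_space M m"
    and "Inf (partition_costs m C D) = 0"
    and "P \<in> C" "Q \<in> D" "A \<in> P" "measure M A > 0"
  shows "\<exists>B\<in>Q. measure M (sym_diff A B) = 0"
proof -
  have PQ: "P \<in> partitions M m" "Q \<in> partitions M m"
    using partition_space_subset[OF assms(1,4)] partition_space_subset[OF assms(2,5)] .
  have A: "A \<in> sets M" using partitions_sets[OF PQ(1) assms(6)] .
  have close: "\<exists>B\<in>Q. measure M (sym_diff A B) < \<epsilon>" if "0 < \<epsilon>" "\<epsilon> \<le> measure M A" for \<epsilon>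
  proof -
    have "Inf (partition_costs m C D) < ennreal \<epsilon>" using assms(3) that by simp
    then obtain c where "c \<in> partition_costs m C D" "c < ennreal \<epsilon>" unfolding Inf_less_iff by blast
    then obtain e f P' Q' where c: "P' \<in> C" "Q' \<in> D" "enumerates (index_set m) e P'"
      "enumerates (index_set m) f Q'"
      "(\<Sum>\<^sub>\<infinity>i\<in>index_set m. emeasure M (sym_diff (e i) (f i))) < ennreal \<epsilon>"
      by (auto simp: partition_costs_def)
    obtain A' where A': "A' \<in> P'" "measure M (sym_diff A A') = 0"
      using partition_rel_obtain[OF partition_space_rel[OF assms(1,4) c(1)] assms(6,7)] .
    obtain i where i: "i \<in> index_set m" "e i = A'" using enumerates_obtain[OF c(3) A'(1)] .
    have S: "e i \<in> sets M" "f i \<in> sets M"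
      using enumerates_sets[OF partition_space_subset[OF assms(1) c(1)] c(3) i(1)]
        enumerates_sets[OF partition_space_subset[OF assms(2) c(2)] c(4) i(1)] .
    have "emeasure M (sym_diff (e i) (f i)) \<le> (\<Sum>\<^sub>\<infinity>i\<in>index_set m. emeasure M (sym_diff (e i) (f i)))"
      using infsum_mono_neutral[of "\<lambda>i. emeasure M (sym_diff (e i) (f i))" "{i}"
          "\<lambda>i. emeasure M (sym_diff (e i) (f i))" "index_set m"] i
      by (simp add: nonneg_summable_on_complete)
    then have "ennreal (measure M (sym_diff (e i) (f i))) < ennreal \<epsilon>"
      using c(5) by (simp add: emeasure_eq_measure)
    then have "measure M (sym_diff (e i) (f i)) < \<epsilon>" by (simp add: ennreal_less_iff)
    then have Af: "measure M (sym_diff A (f i)) < \<epsilon>"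
      using measure_sym_diff_triangle[of A "e i" "f i"] A S A' i by simp
    then have "measure M (f i) > 0"
      using measure_le_sym_diff[of A "f i"] A S that by linarith
    moreover have "f i \<in> Q'" using calculation enumerates_cases[OF c(4) i(1)] by auto
    ultimately obtain B where B: "B \<in> Q" "measure M (sym_diff (f i) B) = 0"
      using partition_rel_obtain[OF partition_space_rel[OF assms(2) c(2) assms(5)]] by blast
    then have "measure M (sym_diff A B) < \<epsilon>"
      using measure_sym_diff_triangle[OF A S(2) partitions_sets[OF PQ(2) B(1)]] Af by simp
    then show ?thesis using B by blast
  qed
  let ?a = "measure M A"
  obtain B where B: "B \<in> Q" "measure M (sym_diff A B) < ?a / 4"
    using close[of "?a / 4"] assms(7) by auto
  have "measure M (sym_diff A B) \<le> 0"
  proof (rule ccontr)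
    assume "\<not> ?thesis"
    then obtain B' where B': "B' \<in> Q" "measure M (sym_diff A B') < measure M (sym_diff A B)"
      using close[of "measure M (sym_diff A B)"] B assms(7) by auto
    then have "B \<noteq> B'" by auto
    then have "B \<inter> B' = {}" using partitions_disjoint[OF PQ(2) B(1) B'(1)] by blast
    then have "A \<subseteq> sym_diff A B \<union> sym_diff A B'" by auto
    moreover have S: "B \<in> sets M" "B' \<in> sets M"
      using partitions_sets[OF PQ(2) B(1)] partitions_sets[OF PQ(2) B'(1)] .
    ultimately have "?a \<le> measure M (sym_diff A B \<union> sym_diff A B')"
      using A by (intro finite_measure_mono) auto
    also have "\<dots> \<le> measure M (sym_diff A B) + measure M (sym_diff A B')"
      using A S by (intro measure_Un_le) auto
    finally show False using B B' assms(7) by linarith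
  qed
  then show ?thesis using B measure_nonneg by (metis order_antisym)
qed

lemma Metric_space_partitions: "Metric_space (partition_space M m) (partition_dist M m)"
proof
  fix C D
  show "0 \<le> partition_dist M m C D" by (simp add: partition_dist_costs)
  show "partition_dist M m C D = partition_dist M m D C"
    by (simp add: partition_dist_costs partition_costs_commute[of m C])
next
  fix C D assume CD: "C \<in> partition_space M m" "D \<in> partition_space M m"
  show "partition_dist M m C D = 0 \<longleftrightarrow> C = D"
  proof
    assume "partition_dist M m C D = 0"
    then have 0: "Inf (partition_costs m C D) = 0"
      using less_imp_neq[OF Inf_partition_costs_finite[OF CD]]
      unfolding partition_dist_costs enn2real_eq_0_iff by blast
    then have 0: "Inf (partition_costs m C D) = 0" "Inf (partition_costs m D C) = 0"
      by (simp_all only: partition_costs_commute[of m D C])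
    obtain P where P: "P \<in> C" "P \<in> partitions M m" using partition_space_obtain CD by metis
    obtain Q where Q: "Q \<in> D" "Q \<in> partitions M m" using partition_space_obtain CD by metis
    have "\<exists>B\<in>Q. measure M (sym_diff A B) = 0" if "A \<in> P" "measure M A > 0" for A
      using partition_costs_zero_aux[OF CD 0(1) P(1) Q(1) that] .
    moreover have "\<exists>A\<in>P. measure M (sym_diff A B) = 0" if "B \<in> Q" "measure M B > 0" for B
      using partition_costs_zero_aux[OF CD(2,1) 0(2) Q(1) P(1) that] by (simp add: Un_commute)
    ultimately have "(P, Q) \<in> partition_rel M m" using P Q by (simp add: partition_rel_def)
    then show "C = D"
      using quotient_eqI[OF equiv_partition_rel] CD P Q unfolding partition_space_def by blast
  next
    assume "C = D"
    obtain P e where "P \<in> C" "enumerates (index_set m) e P" using partition_space_obtain CD by metis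
    then have "(\<Sum>\<^sub>\<infinity>i\<in>index_set m. emeasure M (sym_diff (e i) (e i))) \<in> partition_costs m C D"
      unfolding partition_costs_def \<open>C = D\<close> by blast
    then have "Inf (partition_costs m C D) \<le> 0" by (intro Inf_lower) simp
    then show "partition_dist M m C D = 0" by (simp add: partition_dist_costs)
  qed
next
  fix C D E assume CDE: "C \<in> partition_space M m" "D \<in> partition_space M m" "E \<in> partition_space M m"
  have "partition_dist M m C E \<le>
      enn2real (Inf (partition_costs m C D) + Inf (partition_costs m D E))"
    unfolding partition_dist_costs
    using Inf_partition_costs_triangle[OF CDE] Inf_partition_costs_finite CDE
    by (intro enn2real_mono) (auto simp: ennreal_add_less_top)
  also have "\<dots> = partition_dist M m C D + partition_dist M m D E"
    using Inf_partition_costs_finite CDE by (simp add: partition_dist_costs enn2real_plus)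
  finally show "partition_dist M m C E \<le> partition_dist M m C D + partition_dist M m D E" .
qed

end

end

theory Submission
  imports Defs
begin

text \<open>
  Positive entropy is used only through its consequence that there are sets \<open>A\<close> of arbitrarily small
  positive measure.  The countdown \<open>\<tau>\<close> to the next visit of such an \<open>A\<close> decreases by one under \<open>T\<close>, and
  its residues modulo any \<open>q\<close> far below \<open>1 / \<mu>(A)\<close> are nearly equidistributed, so \<open>\<tau>\<close> replaces a Rokhlin
  tower (no invertibility is needed).  Cut the values of \<open>\<tau>\<close> into segments of a huge length \<open>H\<close> and give
  them types \<open>0, \<dots>, L - 1\<close> cyclically.  Changing a given partition on a set of measure \<open>O(1 / L)\<close>, one
  writes in each segment of type \<open>i\<close> the marker \<open>0 1\<^sup>L\<^sup>+\<^sup>i 0\<close> with period \<open>L\<^sup>2\<close> and destroys all other runs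
  of \<open>L\<close> ones.  Then a block \<open>B\<close> of length between \<open>2 L\<^sup>2\<close> and \<open>2 k L\<^sup>2\<close> determines the type of the segments
  in which it occurs.  If \<open>H\<close> is much larger than \<open>k / \<mu>(B)\<close>, a point outside the segments of this type
  typically does not visit \<open>B\<close> before time \<open>k / \<mu>(B)\<close>, whence \<open>F\<^sub>B(k) = O(1 / L)\<close>.  All of this survives
  small perturbations of the partition, so the partitions with such a window of lengths contain a dense
  open set for every \<open>k\<close>, and Baire's theorem applies.
\<close>

section \<open>Marker words and the runs of ones that they contain\<close>

text \<open>The argument \<open>s\<close> stands for the countdown modulo \<open>L^2\<close>, so it
  falls as time advances; the marker is a palindrome and reads the same in both directions. The
  order of the tests matters: \<open>s = L\<close> lies inside the marker and stays 1, while all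
  larger multiples of \<open>L\<close> become 0 and keep every other run of ones shorter than
  \<open>L\<close>.\<close>

definition mark :: "nat \<Rightarrow> nat \<Rightarrow> nat \<Rightarrow> nat \<Rightarrow> nat" where
  "mark L i s v =
     (if s = 0 \<or> s = L + i + 1 then 0 else if s \<le> L + i then 1 else if L dvd s then 0 else v)"

text \<open>The delimiting zeros must also lie among the first \<open>n\<close> letters. They make
  the length of the run exact, so that the lengths \<open>L + i\<close> tell the types
  \<open>i\<close> apart.\<close>

definition has_run :: "nat \<Rightarrow> (nat \<Rightarrow> nat) \<Rightarrow> nat \<Rightarrow> bool" where
  "has_run n w l \<longleftrightarrow>
     (\<exists>c. c + l + 1 < n \<and> w c = 0 \<and> w (c + l + 1) = 0 \<and> (\<forall>a\<in>{c<..c + l}. w a = 1))"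

text \<open>Two full periods contain a whole marker together with both of its zeros, at whatever
  phase the word starts.\<close>

lemma has_run_mark:
  assumes L: "3 \<le> L" "i < L" and n: "2 * L^2 \<le> n" "n \<le> t"
    and w: "\<And>a. a < n \<Longrightarrow> w a = mark L i ((t - a) mod L^2) (v a)"
  shows "has_run n w (L + i)"
proof -
  define q where "q = L^2"
  have q: "3 * L \<le> q" "q > 0" using L by (auto simp: q_def power2_eq_square)
  \<comment> \<open>The second largest multiple of \<open>q\<close> up to \<open>t\<close>. Position
    \<open>t - b\<close>, of residue 0, is then at least \<open>q\<close> and below
    \<open>2 * q\<close>: inside the word, with room for the rest of the marker before it.\<close>
  define b where "b = (t div q - 1) * q"
  have tq: "t div q \<ge> 2"
    using n q by (metis div_le_mono nonzero_mult_div_cancel_right order.trans q_def neq0_conv)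
  have eqt: "t = b + q + t mod q"
  proof -
    have "t = t div q * q + t mod q" by simp
    also have "t div q * q = (t div q - 1) * q + q" using tq by (cases "t div q") auto
    finally show ?thesis by (simp add: b_def)
  qed
  have tmod: "t mod q < q" using q by simp
  define c where "c = t - (b + L + i + 1)"
  have c1: "c + (L + i) + 1 = t - b" and c2: "t - b < n"
    using eqt tmod L q(1) n(1) unfolding c_def q_def[symmetric] by linarith+
  have idx: "(t - a) mod q = t - b - a" if "c \<le> a" "a \<le> t - b" for a
  proof -
    have "t - a = b + (t - b - a)" using that eqt by simp
    moreover have "b mod q = 0" by (simp add: b_def)
    moreover have "t - b - a < q" using that c1 L q by simp
    ultimately show ?thesis by (metis add_0 mod_add_left_eq mod_less)
  qed
  have ww: "w a = mark L i (t - b - a) (v a)" if "c \<le> a" "a \<le> t - b" for a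
    using w[of a] idx[OF that] that c2 by (simp add: q_def)
  show ?thesis unfolding has_run_def
  proof (intro exI[of _ c] conjI ballI)
    show "c + (L + i) + 1 < n" using c1 c2 by simp
    have "t - b - c = L + i + 1" using c1 by simp
    then show "w c = 0" using ww[of c] c1 by (simp add: mark_def)
    show "w (c + (L + i) + 1) = 0" using ww[of "t - b"] c1 by (simp add: mark_def)
    fix a assume "a \<in> {c<..c + (L + i)}"
    then show "w a = 1" using ww[of a] c1 by (auto simp: mark_def)
  qed
qed

text \<open>A run of at least \<open>L\<close> ones covers a position \<open>a\<close> with
  \<open>t - a\<close> divisible by \<open>L\<close>. Since \<open>L\<close> divides
  \<open>L^2\<close>, the residue there is a multiple of \<open>L\<close>, and the letter 1 is
  possible at such a residue only inside the marker, that is, at residue \<open>L\<close>. This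
  anchors the run in a marker, whose zeros then fix both ends.\<close>

lemma has_run_mark_unique:
  assumes L: "3 \<le> L" "i < L" and n: "n \<le> t"
    and w: "\<And>a. a < n \<Longrightarrow> w a = mark L i ((t - a) mod L^2) (v a)"
    and run: "has_run n w (L + j)"
  shows "j = i"
proof -
  define q where "q = L^2"
  have q: "3 * L \<le> q" "q > 0" "L dvd q" using L by (auto simp: q_def power2_eq_square)
  obtain c where c: "c + (L + j) + 1 < n" "w c = 0" "w (c + (L + j) + 1) = 0"
    "\<And>a. c < a \<Longrightarrow> a \<le> c + (L + j) \<Longrightarrow> w a = 1"
    using run by (auto simp: has_run_def)
  define d where "d = (t - (c + 1)) mod L"
  define a where "a = c + 1 + d"
  have d: "d < L" using L by (simp add: d_def)
  have tc: "c + (L + j) + 1 < t" using c(1) n by simp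
  have a: "c < a" "a \<le> c + (L + j)" using d by (auto simp: a_def)
  have "t - a = (t - (c + 1)) - d" by (simp add: a_def)
  then have dv: "L dvd t - a" unfolding d_def by (simp only: dvd_minus_mod)
  then have "L dvd (t - a) mod q" using q by (simp add: dvd_mod)
  moreover have "mark L i ((t - a) mod q) (v a) = 1"
    using w[of a] c(4)[of a] a c(1) by (simp add: q_def)
  ultimately have o: "L dvd (t - a) mod q" "(t - a) mod q \<noteq> 0" "(t - a) mod q \<le> L + i"
    unfolding mark_def by (auto split: if_splits)
  have "(t - a) mod q = L"
  proof -
    obtain k where k: "(t - a) mod q = L * k" using o(1) by blast
    then have "k \<noteq> 0" using o(2) by auto
    moreover have "L * k < L * 2" using k o(3) L(2) by linarith
    then have "k < 2" by (simp only: mult_less_cancel1)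
    ultimately have "k = 1" by simp
    then show ?thesis using k by simp
  qed
  define b where "b = t - a - L"
  have ba: "t = a + L + b" and b0: "b mod q = 0"
  proof -
    have "(t - a) mod q \<le> t - a" by simp
    then have le: "L \<le> t - a" using \<open>(t - a) mod q = L\<close> by simp
    moreover have "a < t" using a tc by simp
    ultimately show "t = a + L + b" by (simp add: b_def)
    have "b = (t - a) - (t - a) mod q" using \<open>(t - a) mod q = L\<close> by (simp add: b_def)
    then show "b mod q = 0" by (simp add: minus_mod_eq_mult_div)
  qed
  have idx: "w e = mark L i (a + L - e) (v e)" if "e < n" "e \<le> a + L" "a + L - e < q" for e
  proof -
    have "t - e = b + (a + L - e)" using ba that by simp
    then have "(t - e) mod q = a + L - e" using b0 that(3) by (metis add_0 mod_add_left_eq mod_less)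
    then show ?thesis using w[OF that(1)] by (simp add: q_def)
  qed
  have cn: "c < n" using c(1) by simp
  have qb: "a + L - c < q" using d q L by (simp add: a_def)
  have wc: "mark L i (a + L - c) (v c) = 0" using idx[OF cn _ qb] c(2) a by simp
  have low: "L + i < a + L - c"
  proof (rule ccontr)
    assume "\<not> ?thesis"
    then show False using wc a by (auto simp: mark_def split: if_splits)
  qed
  \<comment> \<open>A larger residue at \<open>c\<close> would place the marker's zero of residue
    \<open>L + i + 1\<close> inside the run.\<close>
  have "a + L - c \<le> L + i + 1"
  proof (rule ccontr)
    assume neg: "\<not> ?thesis"
    define e where "e = a - i - 1"
    have e: "c < e" "e \<le> c + (L + j)" "a + L - e = L + i + 1"
      using neg a by (auto simp: e_def)
    have "e < n" "e \<le> a + L" "L + i + 1 < q" using e neg a c(1) L q(1) by auto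
    then show False using idx[of e] c(4)[OF e(1,2)] unfolding e(3) by (simp add: mark_def)
  qed
  with low have ac: "a = c + i + 1" using a by simp
  have ce: "c + (L + j) + 1 \<le> a + L"
  proof (rule ccontr)
    assume neg: "\<not> ?thesis"
    then have "w (a + L) = 1" using c(4)[of "a + L"] a by simp
    moreover have "a + L < n" using neg c(1) by simp
    ultimately show False using idx[of "a + L"] q by (simp add: mark_def)
  qed
  \<comment> \<open>The run ends at residue \<open>i - j\<close>, which is below \<open>L\<close>;
    the only forced zero there is residue 0.\<close>
  have "mark L i (a + L - (c + (L + j) + 1)) (v (c + (L + j) + 1)) = 0"
    using idx[OF c(1) ce] c(3) qb by simp
  then have "a + L - (c + (L + j) + 1) = 0" using ac by (auto simp: mark_def split: if_splits)
  then show "j = i" using ac ce by simp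
qed

section \<open>Recurrence and the distribution of the countdown\<close>

text \<open>Pitfall: the value is arbitrary if the orbit of \<open>x\<close> never visits \<open>A\<close>.\<close>

definition countdown :: "('a \<Rightarrow> 'a) \<Rightarrow> 'a set \<Rightarrow> 'a \<Rightarrow> nat" where
  "countdown T A x = (LEAST i. (T ^^ i) x \<in> A)"

lemma countdown_funpow:
  assumes "\<exists>i. (T ^^ i) x \<in> A" "a \<le> countdown T A x"
  shows "countdown T A ((T ^^ a) x) = countdown T A x - a"
  unfolding countdown_def[of T A "(T ^^ a) x"]
proof (rule Least_equality)
  have "(T ^^ countdown T A x) x \<in> A" using LeastI_ex[OF assms(1)] by (simp add: countdown_def)
  then show "(T ^^ (countdown T A x - a)) ((T ^^ a) x) \<in> A"
    using assms(2) by (simp flip: comp_apply[of "T ^^ _"] funpow_add)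
next
  fix y assume "(T ^^ y) ((T ^^ a) x) \<in> A"
  then have "(T ^^ (y + a)) x \<in> A" by (simp add: funpow_add)
  then have "countdown T A x \<le> y + a" unfolding countdown_def by (rule Least_le)
  then show "countdown T A x - a \<le> y" by simp
qed

context prob_space
begin

lemma prob_vimage:
  assumes "measure_preserving M T" "A \<in> sets M"
  shows "prob (T -` A \<inter> space M) = prob A"
  using assms measure_distr[of T M M A] by (simp add: measure_preserving_def)

lemma prob_vimage_funpow:
  assumes T: "measure_preserving M T" and A: "A \<in> sets M"
  shows "prob {x \<in> space M. (T ^^ n) x \<in> A} = prob A"
proof (induction n)
  case 0
  then show ?case using sets.sets_into_space[OF A] by (simp add: Int_def[symmetric] Int_absorb1)
next
  case (Suc n)
  have [measurable]: "T \<in> M \<rightarrow>\<^sub>M M" using T by (simp add: measure_preserving_def)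
  have [measurable]: "A \<in> sets M" "T ^^ n \<in> M \<rightarrow>\<^sub>M M" using A by (auto intro: measurable_compose_n)
  have "{x \<in> space M. (T ^^ Suc n) x \<in> A} = T -` {x \<in> space M. (T ^^ n) x \<in> A} \<inter> space M"
    using measurable_space[of T M M] by (auto simp: funpow_swap1)
  then show ?case using prob_vimage[OF T, of "{x \<in> space M. (T ^^ n) x \<in> A}"] Suc by simp
qed

text \<open>Ergodicity is stated for exactly invariant sets. The set \<open>R\<close> of points with
  infinitely many visits is exactly invariant, whereas the set of points with at least one visit is
  only known to contain its preimage. As the decreasing limit of the sets \<open>B n\<close>, each
  of probability at least \<open>prob A\<close>, \<open>R\<close> is not null.\<close>

lemma ergodic_recurrence:
  assumes T: "ergodic M T" and A: "A \<in> sets M" "prob A > 0"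
  shows "AE x in M. \<exists>i. (T ^^ i) x \<in> A"
proof -
  have mp: "measure_preserving M T" using T by (simp add: ergodic_def)
  then have TM: "T \<in> M \<rightarrow>\<^sub>M M" by (simp add: measure_preserving_def)
  have [measurable]: "A \<in> sets M" "\<And>n. T ^^ n \<in> M \<rightarrow>\<^sub>M M" using A TM by (auto intro: measurable_compose_n)
  define B where "B n = {x \<in> space M. \<exists>i\<ge>n. (T ^^ i) x \<in> A}" for n
  define R where "R = {x \<in> space M. \<forall>n. \<exists>i\<ge>n. (T ^^ i) x \<in> A}"
  have [measurable]: "B n \<in> sets M" "R \<in> sets M" for n unfolding B_def R_def by measurable
  have inv: "(\<forall>n. \<exists>i\<ge>n. (T ^^ i) (T x) \<in> A) \<longleftrightarrow> (\<forall>n. \<exists>i\<ge>n. (T ^^ i) x \<in> A)" for x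
  proof
    assume *: "\<forall>n. \<exists>i\<ge>n. (T ^^ i) (T x) \<in> A"
    show "\<forall>n. \<exists>i\<ge>n. (T ^^ i) x \<in> A"
    proof
      fix n
      obtain i where "i \<ge> n" "(T ^^ i) (T x) \<in> A" using * by blast
      then show "\<exists>i\<ge>n. (T ^^ i) x \<in> A" by (intro exI[of _ "Suc i"]) (simp add: funpow_swap1)
    qed
  next
    assume *: "\<forall>n. \<exists>i\<ge>n. (T ^^ i) x \<in> A"
    show "\<forall>n. \<exists>i\<ge>n. (T ^^ i) (T x) \<in> A"
    proof
      fix n
      obtain i where "i \<ge> Suc n" "(T ^^ i) x \<in> A" using * by blast
      then show "\<exists>i\<ge>n. (T ^^ i) (T x) \<in> A"
        by (intro exI[of _ "i - 1"]) (cases i; simp add: funpow_swap1)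
    qed
  qed
  have "T -` R \<inter> space M = R"
    unfolding R_def using inv measurable_space[OF TM] by blast
  then have "prob R = 0 \<or> prob R = 1" using T by (simp add: ergodic_def)
  moreover have "prob A \<le> prob R"
  proof -
    have "prob A \<le> prob (B n)" for n
    proof -
      have "prob A = prob {x \<in> space M. (T ^^ n) x \<in> A}"
        using prob_vimage_funpow[OF mp A(1)] by simp
      also have "\<dots> \<le> prob (B n)" by (intro finite_measure_mono) (auto simp: B_def)
      finally show ?thesis .
    qed
    moreover have "(\<lambda>n. prob (B n)) \<longlonglongrightarrow> prob (\<Inter>n. B n)"
      by (intro finite_Lim_measure_decseq) (auto simp: decseq_def B_def intro: order_trans)
    moreover have "(\<Inter>n. B n) = R" by (auto simp: B_def R_def)
    ultimately show ?thesis by (metis LIMSEQ_le_const)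
  qed
  ultimately have "prob R = 1" using A(2) by linarith
  then have "AE x in M. x \<in> R" by (simp add: prob_eq_1)
  then show ?thesis by eventually_elim (auto simp: R_def)
qed

lemma measurable_countdown:
  assumes "T \<in> M \<rightarrow>\<^sub>M M" "A \<in> sets M"
  shows "countdown T A \<in> M \<rightarrow>\<^sub>M count_space UNIV"
proof -
  have [measurable]: "A \<in> sets M" "\<And>n. T ^^ n \<in> M \<rightarrow>\<^sub>M M" using assms by (auto intro: measurable_compose_n)
  show ?thesis unfolding countdown_def[abs_def] by measurable
qed

text \<open>The probability of \<open>\<tau> = j\<close> is at most \<open>\<mu>(A)\<close> and non-increasing in \<open>j\<close>.\<close>

lemma prob_countdown_mod:
  assumes T: "ergodic M T" and A: "A \<in> sets M" "prob A > 0" and q: "q > 0"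
  shows "prob {x \<in> space M. countdown T A x mod q = s} \<le> prob A + 1 / q"
proof (cases "s < q")
  case False
  then have "{x \<in> space M. countdown T A x mod q = s} = {}" using q by auto
  then show ?thesis by (simp only: measure_empty) simp
next
  case s: True
  have mp: "measure_preserving M T" using T by (simp add: ergodic_def)
  then have TM: "T \<in> M \<rightarrow>\<^sub>M M" by (simp add: measure_preserving_def)
  have [measurable]: "A \<in> sets M" "\<And>n. T ^^ n \<in> M \<rightarrow>\<^sub>M M" "T \<in> M \<rightarrow>\<^sub>M M"
    "countdown T A \<in> M \<rightarrow>\<^sub>M count_space UNIV"
    using A TM by (auto intro: measurable_compose_n measurable_countdown)
  define D where "D j = {x \<in> space M. (T ^^ j) x \<in> A \<and> (\<forall>i<j. (T ^^ i) x \<notin> A)}" for j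
  have [measurable]: "D j \<in> sets M" for j unfolding D_def by measurable
  have D_eq: "countdown T A x = j" if "x \<in> D j" for x j
    unfolding countdown_def using that by (intro Least_equality) (auto simp: D_def not_less[symmetric])
  have D_in: "x \<in> D (countdown T A x)" if "x \<in> space M" "\<exists>i. (T ^^ i) x \<in> A" for x
    using that LeastI_ex[OF that(2)] not_less_Least[of _ "\<lambda>i. (T ^^ i) x \<in> A"]
    by (auto simp: D_def countdown_def)
  have step: "prob (D (Suc j)) \<le> prob (D j)" for j
  proof -
    have "D (Suc j) \<subseteq> T -` D j \<inter> space M"
      using measurable_space[OF TM] by (auto simp: D_def funpow_swap1)
    then have "prob (D (Suc j)) \<le> prob (T -` D j \<inter> space M)" by (intro finite_measure_mono) auto
    then show ?thesis using prob_vimage[OF mp] by simp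
  qed
  have anti: "prob (D j) \<le> prob (D i)" if "i \<le> j" for i j
    using lift_Suc_antimono_le[of "\<lambda>j. prob (D j)", OF step that] .
  have disj: "disjoint_family D" using D_eq unfolding disjoint_family_on_def by blast
  have total: "(\<Sum>j<n. prob (D j)) \<le> 1" for n
  proof -
    have "(\<Sum>j<n. prob (D j)) = prob (\<Union>j<n. D j)"
      using disj by (intro finite_measure_finite_Union[symmetric])
        (auto simp: disjoint_family_on_def)
    then show ?thesis by simp
  qed
  define E where "E i = D (i * q + s)" for i
  \<comment> \<open>The inclusion holds only almost everywhere: an orbit that never meets
    \<open>A\<close> has an arbitrary countdown and lies in no \<open>D j\<close>.\<close>
  have "prob {x \<in> space M. countdown T A x mod q = s} \<le> prob (\<Union>i. E i)"
  proof (rule finite_measure_mono_AE)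
    show "AE x in M. x \<in> {x \<in> space M. countdown T A x mod q = s} \<longrightarrow> x \<in> (\<Union>i. E i)"
      using ergodic_recurrence[OF T A] AE_space
    proof eventually_elim
      case (elim x)
      show ?case
      proof
        assume "x \<in> {x \<in> space M. countdown T A x mod q = s}"
        then have "countdown T A x = countdown T A x div q * q + s"
          by (metis (mono_tags, lifting) div_mult_mod_eq mem_Collect_eq)
        then show "x \<in> (\<Union>i. E i)" using D_in[OF elim(2,1)] unfolding E_def by (metis UN_I UNIV_I)
      qed
    qed
  qed (auto simp: E_def)
  also have "\<dots> \<le> prob A + 1 / q"
  proof -
    have "disjoint_family E"
      using disj q by (auto simp: E_def disjoint_family_on_def)
    then have "(\<lambda>i. prob (E i)) sums prob (\<Union>i. E i)"
      by (intro finite_measure_UNION) (auto simp: image_subset_iff, simp add: E_def)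
    moreover have "(\<Sum>i<n. prob (E i)) \<le> prob A + 1 / q" for n
    proof (cases n)
      case (Suc k)
      \<comment> \<open>By monotonicity, each term after the first is at most the average over the
        \<open>q\<close> indices of the preceding period. These averages add up to at most
        \<open>1 / q\<close>; only the first term costs \<open>prob A\<close>.\<close>
      have "prob (E (Suc i)) \<le> (\<Sum>j\<in>{i * q..<i * q + q}. prob (D j)) / q" for i
      proof -
        have "(\<Sum>j\<in>{i * q..<i * q + q}. prob (E (Suc i))) \<le> (\<Sum>j\<in>{i * q..<i * q + q}. prob (D j))"
          unfolding E_def by (intro sum_mono anti) auto
        then show ?thesis using q by (simp add: field_simps)
      qed
      then have "(\<Sum>i<k. prob (E (Suc i))) \<le> (\<Sum>i<k. (\<Sum>j\<in>{i * q..<i * q + q}. prob (D j)) / q)"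
        by (intro sum_mono) auto
      also have "\<dots> = (\<Sum>j<k * q. prob (D j)) / q"
        by (simp add: sum.nat_group flip: sum_divide_distrib)
      also have "\<dots> \<le> 1 / q" using total[of "k * q"] by (intro divide_right_mono) auto
      finally have "(\<Sum>i<k. prob (E (Suc i))) \<le> 1 / q" .
      moreover have "prob (E 0) \<le> prob A"
      proof -
        have "prob (E 0) \<le> prob (D 0)" unfolding E_def by (intro anti) auto
        also have "\<dots> \<le> prob A" by (intro finite_measure_mono) (auto simp: D_def)
        finally show ?thesis .
      qed
      ultimately show ?thesis unfolding Suc sum.lessThan_Suc_shift by simp
    qed simp
    ultimately show ?thesis unfolding sums_def by (intro LIMSEQ_le_const2) auto
  qed
  finally show ?thesis .
qed

lemma prob_countdown_mod_in:
  assumes "ergodic M T" "A \<in> sets M" "prob A > 0" "q > 0" "finite S"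
  shows "prob {x \<in> space M. countdown T A x mod q \<in> S} \<le> card S * (prob A + 1 / q)"
proof -
  have TM: "T \<in> M \<rightarrow>\<^sub>M M" using assms(1) by (simp add: ergodic_def measure_preserving_def)
  have [measurable]: "countdown T A \<in> M \<rightarrow>\<^sub>M count_space UNIV"
    using assms(2) TM by (auto intro: measurable_countdown)
  have "{x \<in> space M. countdown T A x mod q \<in> S} = (\<Union>s\<in>S. {x \<in> space M. countdown T A x mod q = s})"
    by auto
  then have "prob {x \<in> space M. countdown T A x mod q \<in> S} \<le>
      (\<Sum>s\<in>S. prob {x \<in> space M. countdown T A x mod q = s})"
    using assms(5) by (auto intro: finite_measure_subadditive_finite)
  also have "\<dots> \<le> (\<Sum>s\<in>S. prob A + 1 / q)"
    by (intro sum_mono prob_countdown_mod assms)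
  finally show ?thesis by simp
qed

end

section \<open>Blocks, entropy and sets of small measure\<close>

lemma disjoint_blocks:
  assumes "partition_on X P"
  shows "disjoint (blocks M T P n)"
proof (rule disjointI)
  fix B B' assume "B \<in> blocks M T P n" "B' \<in> blocks M T P n" and ne: "B \<noteq> B'"
  then obtain s s' where s: "\<forall>i<n. s i \<in> P" "\<forall>i<n. s' i \<in> P"
    and B: "B = {x \<in> space M. \<forall>i<n. (T ^^ i) x \<in> s i}" "B' = {x \<in> space M. \<forall>i<n. (T ^^ i) x \<in> s' i}"
    unfolding blocks_def by blast
  show "B \<inter> B' = {}"
  proof (rule ccontr)
    assume "B \<inter> B' \<noteq> {}"
    then obtain x where x: "\<And>i. i < n \<Longrightarrow> (T ^^ i) x \<in> s i \<inter> s' i" using B by auto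
    have "s i = s' i" if "i < n" for i
      using partition_onD2[OF assms] s x that disjointD[of P "s i" "s' i"] by blast
    then show False using ne B by auto
  qed
qed

lemma finite_blocks:
  assumes "finite P"
  shows "finite (blocks M T P n)"
proof -
  have "blocks M T P n \<subseteq> (\<lambda>s. {x \<in> space M. \<forall>i<n. (T ^^ i) x \<in> s i}) ` ({..<n} \<rightarrow>\<^sub>E P)"
  proof
    fix B assume "B \<in> blocks M T P n"
    then obtain s where s: "\<forall>i<n. s i \<in> P" "B = {x \<in> space M. \<forall>i<n. (T ^^ i) x \<in> s i}"
      unfolding blocks_def by blast
    then show "B \<in> (\<lambda>s. {x \<in> space M. \<forall>i<n. (T ^^ i) x \<in> s i}) ` ({..<n} \<rightarrow>\<^sub>E P)"
      by (intro image_eqI[of _ _ "restrict s {..<n}"]) auto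
  qed
  then show ?thesis using assms by (meson finite_PiE finite_lessThan finite_imageI finite_subset)
qed

lemma blocks_sets:
  assumes "T \<in> M \<rightarrow>\<^sub>M M" "P \<subseteq> sets M" "B \<in> blocks M T P n"
  shows "B \<in> sets M"
proof -
  have [measurable]: "\<And>n. T ^^ n \<in> M \<rightarrow>\<^sub>M M" using assms(1) by (rule measurable_compose_n)
  obtain s where s: "\<forall>i<n. s i \<in> P" "B = {x \<in> space M. \<forall>i\<in>{..<n}. (T ^^ i) x \<in> s i}"
    using assms(3) unfolding blocks_def by auto
  have "Measurable.pred M (\<lambda>x. (T ^^ i) x \<in> s i)" if "i < n" for i
  proof -
    have [measurable]: "s i \<in> sets M" using s(1) assms(2) that by blast
    show ?thesis by measurable
  qed
  then show ?thesis unfolding s(2) by (intro predE pred_intros_finite) auto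
qed

text \<open>If every non-null set had measure at least \<open>\<eta>\<close>, the information of a
  non-null block would never exceed \<open>- ln \<eta>\<close>. The entropies of the blocks would be
  bounded in \<open>n\<close>, and division by \<open>n\<close> would send them to 0 for every
  finite partition.\<close>

lemma (in prob_space) small_set_if_KS_entropy_pos:
  assumes "T \<in> M \<rightarrow>\<^sub>M M" "KS_entropy M T > 0" "\<eta> > 0"
  shows "\<exists>A\<in>sets M. 0 < prob A \<and> prob A < \<eta>"
proof (rule ccontr)
  assume "\<not> ?thesis"
  then have large: "\<eta> \<le> prob A" if "A \<in> sets M" "prob A \<noteq> 0" for A
    using that measure_nonneg[of M A] by (metis linorder_not_less order_le_less)
  have "\<eta> \<le> 1" using large[of "space M"] by (simp add: prob_space)
  define c where "c = - ln \<eta>"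
  have c: "c \<ge> 0" using \<open>\<eta> \<le> 1\<close> assms(3) by (simp add: c_def)
  have "entropy_wrt M T P = 0" if P: "measurable_partition M P" "finite P" for P
  proof -
    have part: "partition_on (space M) P" "P \<subseteq> sets M" using P by (auto simp: measurable_partition_def)
    have bound: "0 \<le> partition_entropy M (blocks M T P n)" "partition_entropy M (blocks M T P n) \<le> c" for n
    proof -
      let ?B = "blocks M T P n"
      have sets: "\<And>A. A \<in> ?B \<Longrightarrow> A \<in> sets M" using blocks_sets assms(1) part by blast
      have le: "- (prob A * ln (prob A)) \<le> prob A * c" if "A \<in> ?B" for A
      proof (cases "prob A = 0")
        case False
        then have "ln \<eta> \<le> ln (prob A)" using large[OF sets[OF that]] assms(3) by simp
        then have "prob A * ln \<eta> \<le> prob A * ln (prob A)" by (intro mult_left_mono) auto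
        then show ?thesis by (simp add: c_def)
      qed simp
      have pos: "0 \<le> - (prob A * ln (prob A))" if "A \<in> ?B" for A
        by (cases "prob A = 0") (auto simp: mult_le_0_iff zero_less_measure_iff)
      have "(\<Sum>A\<in>?B. prob A) = prob (\<Union>A\<in>?B. A)"
        using sets finite_blocks[OF P(2)] disjoint_blocks[OF part(1)]
        by (intro finite_measure_finite_Union[symmetric]) (auto simp: disjoint_family_on_def disjoint_def)
      then have one: "(\<Sum>A\<in>?B. prob A) \<le> 1" by simp
      have eq: "partition_entropy M ?B = (\<Sum>A\<in>?B. - (prob A * ln (prob A)))"
        by (simp add: partition_entropy_def sum_negf)
      show "0 \<le> partition_entropy M ?B" unfolding eq by (intro sum_nonneg pos)
      have "partition_entropy M ?B \<le> (\<Sum>A\<in>?B. prob A * c)" unfolding eq by (intro sum_mono le)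
      also have "\<dots> = (\<Sum>A\<in>?B. prob A) * c" by (simp add: sum_distrib_right)
      also have "\<dots> \<le> 1 * c" using one c by (intro mult_right_mono)
      finally show "partition_entropy M ?B \<le> c" by simp
    qed
    have "(\<lambda>n. c / real n) \<longlonglongrightarrow> 0" by real_asymp
    then have "(\<lambda>n. partition_entropy M (blocks M T P n) / real n) \<longlonglongrightarrow> 0"
      by (rule tendsto_sandwich[OF _ _ tendsto_const, rotated 2])
        (auto intro!: always_eventually divide_right_mono bound divide_nonneg_nonneg)
    then show ?thesis unfolding entropy_wrt_def by (rule limI)
  qed
  then have "KS_entropy M T \<le> 0" unfolding KS_entropy_def by (intro SUP_least) auto
  then show False using assms(2) by simp
qed

section \<open>Labellings, cylinders and hitting times\<close>

text \<open>Labellings allow partitions to be compared pointwise and single letters to be rewritten.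
  Labels that do not occur are dropped because the elements of a partition are non-empty.\<close>

definition label_partition :: "'a measure \<Rightarrow> ('a \<Rightarrow> nat) \<Rightarrow> 'a set set" where
  "label_partition M f = range (\<lambda>v. f -` {v} \<inter> space M) - {{}}"

definition cylinder :: "'a measure \<Rightarrow> ('a \<Rightarrow> 'a) \<Rightarrow> ('a \<Rightarrow> nat) \<Rightarrow> nat \<Rightarrow> (nat \<Rightarrow> nat) \<Rightarrow> 'a set" where
  "cylinder M T f n w = {x \<in> space M. \<forall>a<n. f ((T ^^ a) x) = w a}"

text \<open>Since blocks are non-empty, each one is the cylinder of the word read along the orbit of
  any of its points.\<close>

lemma blocks_label_partition:
  assumes "T \<in> M \<rightarrow>\<^sub>M M"
  shows "blocks M T (label_partition M f) n =
    (\<lambda>x. cylinder M T f n (\<lambda>a. f ((T ^^ a) x))) ` space M"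
proof (intro subset_antisym subsetI)
  have sp: "(T ^^ a) x \<in> space M" if "x \<in> space M" for x a
    using measurable_space[OF measurable_compose_n[OF assms]] that .
  fix B
  {
    assume "B \<in> blocks M T (label_partition M f) n"
    then obtain s x where s: "\<forall>i<n. s i \<in> label_partition M f"
      "B = {x \<in> space M. \<forall>i<n. (T ^^ i) x \<in> s i}" and x: "x \<in> B"
      unfolding blocks_def by blast
    have "s i = f -` {f ((T ^^ i) x)} \<inter> space M" if i: "i < n" for i
    proof -
      have "(T ^^ i) x \<in> s i" using x s(2) i by blast
      moreover have "s i \<in> range (\<lambda>v. f -` {v} \<inter> space M)" using s(1) i by (simp add: label_partition_def)
      then obtain v where "s i = f -` {v} \<inter> space M" by blast
      ultimately show ?thesis by simp
    qed
    then have "B = cylinder M T f n (\<lambda>a. f ((T ^^ a) x))"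
      using sp by (auto simp: s(2) cylinder_def)
    then show "B \<in> (\<lambda>x. cylinder M T f n (\<lambda>a. f ((T ^^ a) x))) ` space M"
      using x s(2) by auto
  next
    assume "B \<in> (\<lambda>x. cylinder M T f n (\<lambda>a. f ((T ^^ a) x))) ` space M"
    then obtain x where x: "x \<in> space M" "B = cylinder M T f n (\<lambda>a. f ((T ^^ a) x))" by blast
    define s where "s i = f -` {f ((T ^^ i) x)} \<inter> space M" for i
    have "s i \<in> label_partition M f" for i using sp[OF x(1), of i] by (auto simp: s_def label_partition_def)
    moreover have "B = {x \<in> space M. \<forall>i<n. (T ^^ i) x \<in> s i}"
      using sp by (auto simp: x(2) s_def cylinder_def)
    moreover have "x \<in> B" using x by (simp add: cylinder_def)
    ultimately show "B \<in> blocks M T (label_partition M f) n" unfolding blocks_def by blast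
  }
qed

text \<open>Eliminates extended numbers. Positivity of \<open>b\<close> excludes the points that
  never hit \<open>B\<close>; with \<open>b = 0\<close> the convention
  \<open>0 * \<infinity> = 0\<close> would admit them for \<open>t >= 0\<close>.\<close>

lemma hitting_time_le_iff:
  assumes "0 < (b :: real)"
  shows "ereal b * ereal_of_enat (hitting_time T B x) \<le> ereal t \<longleftrightarrow>
    (\<exists>i>0. b * real i \<le> t \<and> (T ^^ i) x \<in> B)"
proof
  assume le: "ereal b * ereal_of_enat (hitting_time T B x) \<le> ereal t"
  let ?S = "{i. 0 < i \<and> (T ^^ i) x \<in> B}"
  show "\<exists>i>0. b * real i \<le> t \<and> (T ^^ i) x \<in> B"
  proof (cases "?S = {}")
    case True
    then have "hitting_time T B x = \<infinity>" by (simp add: hitting_time_def Inf_enat_def)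
    then show ?thesis using le assms by simp
  next
    case False
    then obtain i where "i \<in> ?S" by blast
    then have "(LEAST e. e \<in> enat ` ?S) \<in> enat ` ?S" by (rule LeastI[of "\<lambda>e. e \<in> enat ` ?S", OF imageI])
    then have "hitting_time T B x \<in> enat ` ?S"
      unfolding hitting_time_def Inf_enat_def using False by (simp only: image_is_empty if_False)
    then show ?thesis using le by auto
  qed
next
  assume "\<exists>i>0. b * real i \<le> t \<and> (T ^^ i) x \<in> B"
  then obtain i where i: "i > 0" "b * real i \<le> t" "(T ^^ i) x \<in> B" by blast
  then have "hitting_time T B x \<le> enat i" unfolding hitting_time_def by (intro INF_lower) auto
  then have "ereal_of_enat (hitting_time T B x) \<le> ereal (real i)"
    by (metis ereal_of_enat_le_iff ereal_of_enat_simps(1))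
  then have "ereal b * ereal_of_enat (hitting_time T B x) \<le> ereal b * ereal (real i)"
    using assms by (intro ereal_mult_left_mono) auto
  also have "\<dots> \<le> ereal t" using i by simp
  finally show "ereal b * ereal_of_enat (hitting_time T B x) \<le> ereal t" .
qed

lemma hitting_distr_eq:
  assumes "0 < measure M B"
  shows "hitting_distr M T B t =
    measure M {x \<in> space M. \<exists>i>0. measure M B * real i \<le> t \<and> (T ^^ i) x \<in> B}"
  unfolding hitting_distr_def hitting_time_le_iff[OF assms] ..

lemma (in prob_space) hitting_distr_mono:
  assumes "T \<in> M \<rightarrow>\<^sub>M M" "B \<in> sets M" "0 < prob B" "s \<le> t"
  shows "hitting_distr M T B s \<le> hitting_distr M T B t"
proof -
  have [measurable]: "B \<in> sets M" "\<And>n. T ^^ n \<in> M \<rightarrow>\<^sub>M M" using assms by (auto intro: measurable_compose_n)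
  show ?thesis unfolding hitting_distr_eq[OF assms(3)]
    using assms(4) by (intro finite_measure_mono) (auto intro: order_trans)
qed

lemma measurable_cylinder:
  assumes "T \<in> M \<rightarrow>\<^sub>M M" "f \<in> M \<rightarrow>\<^sub>M count_space UNIV"
  shows "cylinder M T f n w \<in> sets M"
proof -
  have [measurable]: "\<And>n. T ^^ n \<in> M \<rightarrow>\<^sub>M M" "f \<in> M \<rightarrow>\<^sub>M count_space UNIV"
    using assms by (auto intro: measurable_compose_n)
  show ?thesis unfolding cylinder_def by measurable
qed

section \<open>Hitting times of the blocks of a marked labelling\<close>

text \<open>For a countdown \<open>t\<close>: as long as the elapsed time does not exceed the
  residue modulo \<open>H\<close>, the orbit stays in its segment and keeps its type.\<close>

lemma div_diff_same_segment:
  fixes t H s :: nat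
  assumes "s \<le> t mod H"
  shows "(t - s) div H = t div H"
proof (cases "H = 0")
  case False
  have "t - s = t div H * H + (t mod H - s)"
    using assms div_mult_mod_eq[of t H] by linarith
  moreover have "t mod H - s < H" using False by (simp add: less_imp_diff_less)
  ultimately show ?thesis using False by (simp only: div_mult_self3 div_less) simp
qed simp

context prob_space
begin

text \<open>
  \<open>G\<close> is the set of points whose next \<open>J + N\<close> iterates stay in one segment and on which \<open>g\<close> agrees with
  the marked labels \<open>f\<close>.  Blocks of measure less than \<open>\<beta>\<close> are discarded, so that \<open>J\<close> bounds all hitting
  times in question.
\<close>

lemma prob_attracting_blocks:
  fixes T :: "'a \<Rightarrow> 'a" and A :: "'a set" and h g :: "'a \<Rightarrow> nat" and L H n J N k c :: nat
  defines "f \<equiv> \<lambda>x. mark L ((countdown T A x div H) mod L) (countdown T A x mod L^2) (h x)"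
  assumes T: "T \<in> M \<rightarrow>\<^sub>M M" and g: "g \<in> M \<rightarrow>\<^sub>M count_space UNIV"
    and A: "A \<in> sets M"
    and L: "3 \<le> L" and n: "2 * L^2 \<le> n" "n \<le> N"
    and h: "\<And>x. h x < c" and c: "2 \<le> c"
    and G: "G \<in> sets M" "prob (space M - G) \<le> \<gamma>"
      "\<And>x. x \<in> G \<Longrightarrow> \<exists>i. (T ^^ i) x \<in> A"
      "\<And>x. x \<in> G \<Longrightarrow> J + N \<le> countdown T A x mod H"
      "\<And>x s. x \<in> G \<Longrightarrow> s < J + N \<Longrightarrow> g ((T ^^ s) x) = f ((T ^^ s) x)"
    and \<theta>: "\<And>i. prob {x \<in> space M. (countdown T A x div H) mod L = i} \<le> \<theta>" "\<gamma> + \<theta> < r"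
    and \<beta>: "0 < \<beta>" "real k \<le> real J * \<beta>"
  shows "1 - (real (c ^ n) * \<beta> + \<gamma>) \<le> prob (\<Union>{B \<in> blocks M T (label_partition M g) n.
    0 < prob B \<and> hitting_distr M T B k < r})"
proof -
  let ?t = "countdown T A" and ?C = "cylinder M T g n"
  define w where "w y a = g ((T ^^ a) y)" for y a
  have [measurable]: "?t \<in> M \<rightarrow>\<^sub>M count_space UNIV" "G \<in> sets M" "\<And>n. T ^^ n \<in> M \<rightarrow>\<^sub>M M"
    using measurable_countdown[OF T A] G T by (auto intro: measurable_compose_n)
  have Cs[measurable]: "?C v \<in> sets M" for v using measurable_cylinder[OF T g] .
  \<comment> \<open>All words of length \<open>n\<close> read from an orbit of \<open>G\<close> up
    to time \<open>J\<close> carry the type of the starting point.\<close>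
  have word: "w ((T ^^ s) x) a = mark L ((?t x div H) mod L) ((?t x - s - a) mod L^2) (h ((T ^^ (s + a)) x))"
    if "x \<in> G" "s \<le> J" "a < n" for x s a
  proof -
    have sa: "s + a < J + N" "s + a \<le> ?t x mod H" "s + a \<le> ?t x"
      using that n(2) G(4)[OF that(1)] mod_less_eq_dividend[of "?t x" H] by linarith+
    have "?t ((T ^^ (s + a)) x) = ?t x - (s + a)"
      using countdown_funpow[OF G(3)[OF that(1)] sa(3)] .
    moreover have "w ((T ^^ s) x) a = g ((T ^^ (s + a)) x)" by (simp add: w_def funpow_add add.commute[of s])
    ultimately show ?thesis
      using G(5)[OF that(1) sa(1)] div_diff_same_segment[OF sa(2)] by (simp add: f_def)
  qed
  \<comment> \<open>The word of \<open>y\<close> has a run that encodes the type of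
    \<open>y\<close>. If it reappears on the orbit of \<open>x\<close>, uniqueness of such runs
    forces the type of \<open>x\<close> to agree.\<close>
  have type_eq: "(?t x div H) mod L = (?t y div H) mod L"
    if "x \<in> G" "y \<in> G" "s \<le> J" "(T ^^ s) x \<in> ?C (w y)" for x y s
  proof -
    have nt: "n \<le> ?t y" "n \<le> ?t x - s"
      using that n(2) G(4)[OF that(1)] G(4)[OF that(2)] mod_less_eq_dividend[of "?t x" H]
        mod_less_eq_dividend[of "?t y" H] by linarith+
    have "w y a = mark L ((?t y div H) mod L) ((?t y - a) mod L^2) (h ((T ^^ a) y))" if "a < n" for a
      using word[OF \<open>y \<in> G\<close>, of 0] that by simp
    then have "has_run n (w y) (L + (?t y div H) mod L)"
      using has_run_mark[OF L _ n(1) nt(1), of "(?t y div H) mod L" "w y" "\<lambda>a. h ((T ^^ a) y)"] L by simp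
    moreover have "w y a = mark L ((?t x div H) mod L) ((?t x - s - a) mod L^2) (h ((T ^^ (s + a)) x))"
      if "a < n" for a
      using word[OF \<open>x \<in> G\<close> \<open>s \<le> J\<close> that] \<open>(T ^^ s) x \<in> ?C (w y)\<close> that by (simp add: cylinder_def w_def)
    ultimately show ?thesis
      using has_run_mark_unique[OF L _ nt(2), of "(?t x div H) mod L" "w y"
          "\<lambda>a. h ((T ^^ (s + a)) x)" "(?t y div H) mod L"] L by simp
  qed
  \<comment> \<open>Because the block has measure at least \<open>\<beta>\<close>, a normalized time
    at most \<open>k\<close> means at most \<open>J\<close> steps. Within these, a point of
    \<open>G\<close> can hit the block only if it has the type of \<open>y\<close>, which has
    probability at most \<open>\<theta>\<close>.\<close>
  have hit: "hitting_distr M T (?C (w y)) k < r"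
    if "y \<in> G" "\<beta> \<le> prob (?C (w y))" for y
  proof -
    have pos: "0 < prob (?C (w y))" using that \<beta> by simp
    have "i \<le> J" if "prob (?C (w y)) * real i \<le> real k" for i
    proof -
      have "\<beta> * real i \<le> prob (?C (w y)) * real i"
        using \<open>\<beta> \<le> prob (?C (w y))\<close> by (intro mult_right_mono) auto
      then have "\<beta> * real i \<le> \<beta> * real J" using that \<beta>(2) by (simp add: mult.commute)
      then show ?thesis using \<beta>(1) by (simp only: mult_le_cancel_left_pos of_nat_le_iff)
    qed
    then have "{x \<in> space M. \<exists>i>0. prob (?C (w y)) * real i \<le> real k \<and> (T ^^ i) x \<in> ?C (w y)} \<subseteq>
        (space M - G) \<union> {x \<in> space M. (?t x div H) mod L = (?t y div H) mod L}"
      using type_eq[OF _ \<open>y \<in> G\<close>] by blast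
    then have "hitting_distr M T (?C (w y)) k \<le>
        prob ((space M - G) \<union> {x \<in> space M. (?t x div H) mod L = (?t y div H) mod L})"
      unfolding hitting_distr_eq[OF pos] by (intro finite_measure_mono) auto
    also have "\<dots> \<le> prob (space M - G) + prob {x \<in> space M. (?t x div H) mod L = (?t y div H) mod L}"
      by (intro measure_Un_le) auto
    also have "\<dots> \<le> \<gamma> + \<theta>" using G(2) \<theta>(1) by (intro add_mono)
    also note \<theta>(2)
    finally show ?thesis .
  qed
  let ?U = "\<Union>{B \<in> blocks M T (label_partition M g) n. 0 < prob B \<and> hitting_distr M T B k < r}"
  let ?W = "{..<n} \<rightarrow>\<^sub>E {..<c}"
  \<comment> \<open>On \<open>G\<close> only letters below \<open>c\<close> are read. So at most
    \<open>c ^ n\<close> blocks meeting \<open>G\<close> are discarded, each of measure less than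
    \<open>\<beta>\<close>.\<close>
  define S where "S v = (if prob (?C v) < \<beta> then ?C v else {})" for v
  have blk: "blocks M T (label_partition M g) n = (\<lambda>x. ?C (w x)) ` space M"
    unfolding blocks_label_partition[OF T] w_def[abs_def] ..
  \<comment> \<open>Off \<open>G\<close> the labelling \<open>g\<close> may take infinitely many
    values, so the blocks need not be finite in number; they are indexed by finite lists of
    labels.\<close>
  have "countable (blocks M T (label_partition M g) n)"
  proof -
    have "(\<lambda>x. ?C (w x)) ` space M \<subseteq> range (\<lambda>l. ?C (\<lambda>a. l ! a))"
    proof (intro image_subsetI)
      fix x
      have "?C (w x) = ?C (\<lambda>a. map (w x) [0..<n] ! a)" by (simp add: cylinder_def)
      then show "?C (w x) \<in> range (\<lambda>l. ?C (\<lambda>a. l ! a))" by blast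
    qed
    then show ?thesis unfolding blk by (rule countable_subset) auto
  qed
  then have U[measurable]: "?U \<in> sets M"
    by (intro sets.countable_Union) (auto simp: blk intro: countable_subset)
  have Ss: "S v \<in> sets M" for v by (simp add: S_def)
  then have SU: "(\<Union>v\<in>?W. S v) \<in> sets M" by (intro sets.finite_UN finite_PiE) auto
  have GC: "space M - G \<in> sets M" using G(1) by auto
  have "space M \<subseteq> ?U \<union> ((\<Union>v\<in>?W. S v) \<union> (space M - G))"
  proof
    fix x assume x: "x \<in> space M"
    show "x \<in> ?U \<union> ((\<Union>v\<in>?W. S v) \<union> (space M - G))"
    proof (cases "x \<in> G")
      case True
      have xC: "x \<in> ?C (w x)" using x by (simp add: cylinder_def w_def)
      show ?thesis
      proof (cases "prob (?C (w x)) < \<beta>")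
        case small: True
        let ?v = "restrict (w x) {..<n}"
        have "w x a < c" if "a < n" for a
          using word[OF True, of 0 a] that h c by (simp add: mark_def)
        then have "?v \<in> ?W" by auto
        moreover have "?C ?v = ?C (w x)" by (simp add: cylinder_def)
        then have "x \<in> S ?v" using xC small by (simp only: S_def if_True)
        ultimately show ?thesis by blast
      next
        case False
        then have "?C (w x) \<in> {B \<in> blocks M T (label_partition M g) n.
            0 < prob B \<and> hitting_distr M T B k < r}"
          using hit[OF True] x \<beta> by (auto simp: blk)
        then show ?thesis using xC by blast
      qed
    qed (use x in simp)
  qed
  then have "prob (space M) \<le> prob (?U \<union> ((\<Union>v\<in>?W. S v) \<union> (space M - G)))"
    by (intro finite_measure_mono sets.Un U SU GC)
  also have "\<dots> \<le> prob ?U + prob ((\<Union>v\<in>?W. S v) \<union> (space M - G))"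
    by (rule measure_Un_le[OF U sets.Un[OF SU GC]])
  also have "prob ((\<Union>v\<in>?W. S v) \<union> (space M - G)) \<le> prob (\<Union>v\<in>?W. S v) + prob (space M - G)"
    by (rule measure_Un_le[OF SU GC])
  also have "prob (\<Union>v\<in>?W. S v) \<le> (\<Sum>v\<in>?W. prob (S v))"
    using Ss by (intro finite_measure_subadditive_finite finite_PiE) auto
  also have "\<dots> \<le> (\<Sum>v\<in>?W. \<beta>)" using \<beta> by (intro sum_mono) (auto simp: S_def)
  also have "\<dots> = real (c ^ n) * \<beta>" by (simp add: card_PiE)
  finally show ?thesis using G(2) by (simp add: prob_space)
qed

end

section \<open>Perturbation to a labelling with a stable window of lengths\<close>

lemma measurable_count_space_UNIV:
  assumes "f \<in> M \<rightarrow>\<^sub>M count_space I"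
  shows "f \<in> M \<rightarrow>\<^sub>M count_space UNIV"
  by (rule measurable_compose[OF assms, of "\<lambda>x. x"]) simp

lemma pred_nat_eq [measurable]:
  fixes f g :: "'a \<Rightarrow> nat"
  assumes [measurable]: "f \<in> M \<rightarrow>\<^sub>M count_space UNIV" "g \<in> M \<rightarrow>\<^sub>M count_space UNIV"
  shows "Measurable.pred M (\<lambda>x. f x = g x)"
proof -
  have eq: "(\<lambda>x. \<exists>n. f x = n \<and> g x = n) = (\<lambda>x. f x = g x)" by auto
  have "Measurable.pred M (\<lambda>x. \<exists>n. f x = n \<and> g x = n)" by measurable
  then show ?thesis unfolding eq .
qed

lemma measurable_count_space_subset:
  assumes "f \<in> M \<rightarrow>\<^sub>M count_space UNIV" "f ` space M \<subseteq> I"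
  shows "f \<in> M \<rightarrow>\<^sub>M count_space I"
  using assms unfolding measurable_def by auto

text \<open>The lengths from \<open>n0\<close> to \<open>k * n0\<close> fill a proportion of at
  least \<open>1 - 1 / k\<close> of all lengths up to \<open>k * n0\<close>, which gives upper
  density 1 as \<open>k\<close> grows; \<open>n0 >= k\<close> drives the windows to infinity. For
  fixed \<open>k\<close> only finitely many lengths are concerned, so that the condition can survive
  small perturbations.\<close>

definition attracting_window :: "'a measure \<Rightarrow> ('a \<Rightarrow> 'a) \<Rightarrow> 'a set set \<Rightarrow> nat \<Rightarrow> bool" where
  "attracting_window M T P k \<longleftrightarrow> (\<exists>n0\<ge>k. \<forall>n\<in>{n0..k * n0}.
     1 - 1 / real k < measure M (\<Union>{B \<in> blocks M T P n. 0 < measure M B \<and> hitting_distr M T B k < 1 / real k}))"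

lemma mark_eq_self:
  assumes "i < L" "s < L^2" "s \<notin> {..2 * L} \<union> (*) L ` {..<L}"
  shows "mark L i s v = v"
proof -
  have "\<not> L dvd s"
  proof
    assume "L dvd s"
    then obtain q where q: "s = L * q" by blast
    then have "q < L" using assms(2) by (simp add: power2_eq_square)
    then show False using assms(3) q by blast
  qed
  then show ?thesis using assms by (auto simp: mark_def)
qed

context prob_space
begin

text \<open>The constants are chosen in order: \<open>c\<close> and \<open>L\<close> from
  \<open>\<epsilon>\<close> and \<open>k\<close>, then the lengths, \<open>\<beta>\<close>,
  \<open>J\<close> and \<open>H\<close>, and only then the set \<open>A\<close>. A labelling
  \<open>g\<close> near \<open>f'\<close> agrees with it along \<open>J + N\<close> iterates of most
  points, which is all that the bound on hitting times looks at. The markers use the labels 0 and 1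
  only, so \<open>f'\<close> stays within \<open>I\<close>.\<close>

lemma attracting_window_perturbation:
  assumes erg: "ergodic M T"
    and small: "\<And>\<eta>. \<eta> > 0 \<Longrightarrow> \<exists>A\<in>sets M. 0 < prob A \<and> prob A < \<eta>"
    and f: "f \<in> M \<rightarrow>\<^sub>M count_space I" and I: "0 \<in> I" "1 \<in> I"
    and \<epsilon>: "0 < \<epsilon>" and k: "1 \<le> (k :: nat)"
  shows "\<exists>f' \<delta>. f' \<in> M \<rightarrow>\<^sub>M count_space I \<and> prob {x \<in> space M. f' x \<noteq> f x} < \<epsilon> \<and> 0 < \<delta> \<and>
    (\<forall>g. g \<in> M \<rightarrow>\<^sub>M count_space UNIV \<and> prob {x \<in> space M. g x \<noteq> f' x} < \<delta> \<longrightarrow>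
      attracting_window M T (label_partition M g) k)"
proof -
  have mp: "measure_preserving M T" using erg by (simp add: ergodic_def)
  then have T: "T \<in> M \<rightarrow>\<^sub>M M" by (simp add: measure_preserving_def)
  have fU: "f \<in> M \<rightarrow>\<^sub>M count_space UNIV" "f ` space M \<subseteq> I" 
    using measurable_count_space_UNIV[OF f] measurable_space[OF f] by auto
  note [measurable] = T
  have [measurable]: "\<And>n. T ^^ n \<in> M \<rightarrow>\<^sub>M M" "f \<in> M \<rightarrow>\<^sub>M count_space UNIV"
    using T fU by (auto intro: measurable_compose_n)
  \<comment> \<open>Infinitely many labels may occur; merging the rare large ones into 0 bounds the
    number of words by \<open>c ^ n\<close>.\<close>
  obtain c where c: "2 \<le> c" "prob {x \<in> space M. c \<le> f x} < \<epsilon> / 2"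
  proof -
    define S where "S c = {x \<in> space M. c \<le> f x}" for c
    have "(\<lambda>c. prob (S c)) \<longlonglongrightarrow> prob (\<Inter>c. S c)"
      by (intro finite_Lim_measure_decseq) (auto simp: decseq_def S_def)
    moreover have "(\<Inter>c. S c) = {}" by (auto simp: S_def) (metis not_less_eq_eq order_refl)
    ultimately have "eventually (\<lambda>c. prob (S c) < \<epsilon> / 2) sequentially"
      using \<epsilon> by (intro order_tendstoD(2)[of _ 0]) auto
    then obtain c0 where "\<And>c. c \<ge> c0 \<Longrightarrow> prob (S c) < \<epsilon> / 2" by (auto simp: eventually_sequentially)
    then show ?thesis using that[of "c0 + 2"] by (simp add: S_def)
  qed
  define h where "h x = (if f x < c then f x else 0)" for x
  define L where "L = nat \<lceil>16 / \<epsilon>\<rceil> + 8 * k + 3"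
  have L: "3 \<le> L" "8 * k \<le> L" by (simp_all add: L_def)
  have "16 / \<epsilon> < real L" unfolding L_def by linarith
  then have L\<epsilon>: "8 / real L < \<epsilon> / 2" using \<epsilon> L by (simp add: field_simps)
  define p where "p = L^2"
  define n0 where "n0 = 2 * p"
  define N where "N = k * n0"
  \<comment> \<open>The value of \<open>\<beta>\<close> limits the discarded measure
    \<open>c ^ n * \<beta>\<close> to \<open>1 / (4 * k)\<close>, and \<open>J\<close> is
    \<open>k / \<beta>\<close>. The length \<open>H\<close> makes the last \<open>J + N\<close>
    positions of a segment have probability at most \<open>1 / (8 * k * p)\<close>.\<close>
  define \<beta> where "\<beta> = 1 / (4 * real k * real (c ^ N))"
  define J where "J = 4 * k^2 * c ^ N"
  define H where "H = 16 * k * p * (J + N)"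
  have p: "0 < p" "L \<le> p" using L by (auto simp: p_def power2_eq_square)
  have N: "0 < N" using p k by (simp add: N_def n0_def)
  have cN: "0 < c ^ N" using c by simp
  have J: "0 < J" "real k = real J * \<beta>" using k cN
    by (simp_all add: J_def \<beta>_def power2_eq_square)
  have H: "0 < H" "p \<le> H" using k p J by (simp_all add: H_def)
  have \<beta>: "0 < \<beta>" using k cN by (simp add: \<beta>_def)
  \<comment> \<open>With \<open>prob A\<close> below \<open>1 / (H * L)\<close>, every residue
    modulo any \<open>q\<close> up to \<open>H * L\<close> has probability at most
    \<open>2 / q\<close>. The moduli needed are \<open>p\<close>, \<open>H\<close> and
    \<open>H * L\<close>.\<close>
  obtain A where A: "A \<in> sets M" "0 < prob A" "prob A < 1 / (real H * real L)"
    using small[of "1 / (real H * real L)"] H L by auto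
  have prob_A: "prob A \<le> 1 / real q" if "0 < q" "q \<le> H * L" for q
  proof -
    have "1 / real (H * L) \<le> 1 / real q" using that H L by (intro divide_left_mono) (auto simp del: of_nat_mult)
    then show ?thesis using A by simp
  qed
  let ?t = "countdown T A"
  have [measurable]: "?t \<in> M \<rightarrow>\<^sub>M count_space UNIV" "A \<in> sets M" using measurable_countdown[OF T A(1)] A by auto
  have prob_mod: "prob {x \<in> space M. ?t x mod q \<in> S} \<le> real (card S) * (2 / real q)"
    if "0 < q" "q \<le> H * L" "finite S" for q S
  proof -
    have "real (card S) * (prob A + 1 / real q) \<le> real (card S) * (2 / real q)"
      using prob_A[OF that(1,2)] by (intro mult_left_mono) (auto simp: field_simps)
    then show ?thesis using prob_countdown_mod_in[OF erg A(1,2) that(1,3)] by linarith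
  qed
  define f' where "f' = (\<lambda>x. mark L ((?t x div H) mod L) (?t x mod L^2) (h x))"
  have f'U: "f' \<in> M \<rightarrow>\<^sub>M count_space UNIV" unfolding f'_def mark_def h_def by measurable
  note [measurable] = f'U
  show ?thesis
  \<comment> \<open>The radius \<open>1 / (8 * k * (J + N))\<close> is such that disagreement at any
    of \<open>J + N\<close> iterates costs at most \<open>1 / (8 * k)\<close> in total.\<close>
  proof (intro exI[of _ f'] exI[of _ "1 / (8 * real k * real (J + N))"] conjI allI impI)
    have "f' ` space M \<subseteq> I" using fU(2) I by (auto simp: f'_def mark_def h_def)
    then show "f' \<in> M \<rightarrow>\<^sub>M count_space I" by (rule measurable_count_space_subset[OF f'U])
  next
    \<comment> \<open>The residues at which marking may alter a letter: at most \<open>4 * L\<close>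
      out of \<open>L^2\<close>.\<close>
    let ?R = "{..2 * L} \<union> (*) L ` {..<L}"
    have "{x \<in> space M. f' x \<noteq> f x} \<subseteq> {x \<in> space M. c \<le> f x} \<union> {x \<in> space M. ?t x mod p \<in> ?R}"
    proof
      fix x assume x: "x \<in> {x \<in> space M. f' x \<noteq> f x}"
      show "x \<in> {x \<in> space M. c \<le> f x} \<union> {x \<in> space M. ?t x mod p \<in> ?R}"
      proof (rule ccontr)
        assume "\<not> ?thesis"
        then have *: "f x < c" "?t x mod p \<notin> ?R" using x by auto
        have "mark L ((?t x div H) mod L) (?t x mod L^2) (h x) = h x"
          using *(2) L p by (intro mark_eq_self) (auto simp: p_def)
        then show False using x *(1) by (simp add: f'_def h_def)
      qed
    qed
    then have "prob {x \<in> space M. f' x \<noteq> f x} \<le>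
        prob ({x \<in> space M. c \<le> f x} \<union> {x \<in> space M. ?t x mod p \<in> ?R})"
      by (intro finite_measure_mono) auto
    also have "\<dots> \<le> prob {x \<in> space M. c \<le> f x} + prob {x \<in> space M. ?t x mod p \<in> ?R}"
      by (intro measure_Un_le) auto
    also have "prob {x \<in> space M. ?t x mod p \<in> ?R} \<le> real (card ?R) * (2 / real p)"
      using p H L by (intro prob_mod) (auto intro: order_trans)
    also have "\<dots> \<le> real (4 * L) * (2 / real p)"
    proof -
      have "card ?R \<le> card {..2 * L} + card ((*) L ` {..<L})" by (rule card_Un_le)
      also have "\<dots> \<le> Suc (2 * L) + L" using card_image_le[of "{..<L}" "(*) L"] by simp
      also have "\<dots> \<le> 4 * L" using L by simp
      finally show ?thesis by (intro mult_right_mono) auto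
    qed
    also have "\<dots> = 8 / real L" using L by (simp add: p_def power2_eq_square)
    finally show "prob {x \<in> space M. f' x \<noteq> f x} < \<epsilon>" using c(2) L\<epsilon> by linarith
  next
    show "0 < 1 / (8 * real k * real (J + N))" using k N by simp
  next
    fix g assume "g \<in> M \<rightarrow>\<^sub>M count_space UNIV \<and>
      prob {x \<in> space M. g x \<noteq> f' x} < 1 / (8 * real k * real (J + N))"
    then have g[measurable]: "g \<in> M \<rightarrow>\<^sub>M count_space UNIV"
      and dist: "prob {x \<in> space M. g x \<noteq> f' x} < 1 / (8 * real k * real (J + N))" by blast+
    define G where "G = {x \<in> space M. (\<exists>i. (T ^^ i) x \<in> A) \<and> J + N \<le> ?t x mod H \<and>
      (\<forall>s\<in>{..<J + N}. g ((T ^^ s) x) = f' ((T ^^ s) x))}"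
    have "Measurable.pred M (\<lambda>x. g x = f' x)" by measurable
    from measurable_compose[OF measurable_compose_n[OF T] this]
    have [measurable]: "Measurable.pred M (\<lambda>x. g ((T ^^ s) x) = f' ((T ^^ s) x))" for s .
    have [measurable]: "G \<in> sets M" unfolding G_def by measurable
    let ?D = "\<lambda>s. {x \<in> space M. (T ^^ s) x \<in> {x \<in> space M. g x \<noteq> f' x}}"
    have "prob (space M - G) \<le> prob ({x \<in> space M. ?t x mod H \<in> {..<J + N}} \<union> (\<Union>s<J + N. ?D s))"
    proof (rule finite_measure_mono_AE)
      show "AE x in M. x \<in> space M - G \<longrightarrow>
          x \<in> {x \<in> space M. ?t x mod H \<in> {..<J + N}} \<union> (\<Union>s<J + N. ?D s)"
        using ergodic_recurrence[OF erg A(1,2)]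
      proof eventually_elim
        case (elim x)
        have "(T ^^ s) x \<in> space M" if "x \<in> space M" for s
          using measurable_space[OF measurable_compose_n[OF T]] that .
        then show ?case using elim by (auto simp: G_def not_le)
      qed
    qed auto
    also have "\<dots> \<le> prob {x \<in> space M. ?t x mod H \<in> {..<J + N}} + prob (\<Union>s<J + N. ?D s)"
      by (intro measure_Un_le) auto
    also have "prob (\<Union>s<J + N. ?D s) \<le> (\<Sum>s<J + N. prob (?D s))"
      by (intro finite_measure_subadditive_finite) auto
    also have "\<dots> = (\<Sum>s<J + N. prob {x \<in> space M. g x \<noteq> f' x})"
      by (intro sum.cong refl prob_vimage_funpow[OF mp]) auto
    also have "\<dots> \<le> (\<Sum>s<J + N. 1 / (8 * real k * real (J + N)))"
      using dist by (intro sum_mono) simp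
    also have "\<dots> = 1 / (8 * real k)" using N by simp
    also have "prob {x \<in> space M. ?t x mod H \<in> {..<J + N}} \<le> real (card {..<J + N}) * (2 / real H)"
      using H L by (intro prob_mod) auto
    also have "\<dots> = 1 / (8 * real k * real p)" using N by (simp add: H_def)
    also have "\<dots> \<le> 1 / (8 * real k)" using k p by (simp add: field_simps)
    finally have G: "prob (space M - G) \<le> 1 / (4 * real k)" using k by (simp add: field_simps)
    have type: "prob {x \<in> space M. (?t x div H) mod L = i} \<le> 1 / (4 * real k)" for i
    proof -
      \<comment> \<open>A type corresponds to an interval of \<open>H\<close> residues modulo
        \<open>H * L\<close>.\<close>
      have "prob {x \<in> space M. (?t x div H) mod L = i} \<le>
          prob {x \<in> space M. ?t x mod (H * L) \<in> {H * i..<H * i + H}}"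
        using H by (intro finite_measure_mono) (auto simp: mod_mult2_eq)
      also have "\<dots> \<le> real (card {H * i..<H * i + H}) * (2 / real (H * L))"
        using H L by (intro prob_mod) auto
      also have "\<dots> = 2 / real L" using H by simp
      also have "\<dots> \<le> 1 / (4 * real k)" using L k by (simp add: field_simps)
      finally show ?thesis .
    qed
    show "attracting_window M T (label_partition M g) k" unfolding attracting_window_def
    proof (intro exI[of _ n0] conjI ballI)
      show "k \<le> n0" using L p by (simp add: n0_def)
      fix n assume n: "n \<in> {n0..k * n0}"
      let ?U = "\<Union>{B \<in> blocks M T (label_partition M g) n. 0 < prob B \<and> hitting_distr M T B k < 1 / real k}"
      have "1 - (real (c ^ n) * \<beta> + 1 / (4 * real k)) \<le> prob ?U"
      proof (rule prob_attracting_blocks[where c = c and A = A and h = h and L = L and H = H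
            and J = J and N = N and G = G])
        show "2 * L^2 \<le> n" "n \<le> N" using n by (auto simp: n0_def N_def p_def)
        show "h x < c" for x using c by (simp add: h_def)
        show "real k \<le> real J * \<beta>" using J by simp
        show "g ((T ^^ s) x) = mark L ((?t ((T ^^ s) x) div H) mod L) (?t ((T ^^ s) x) mod L^2) (h ((T ^^ s) x))"
          if "x \<in> G" "s < J + N" for x s
          using that by (simp add: G_def f'_def)
        show "1 / (4 * real k) + 1 / (4 * real k) < 1 / real k" using k by (simp add: field_simps)
      qed (use T g A L c G \<beta> type in \<open>auto simp: G_def\<close>)
      moreover have "real (c ^ n) * \<beta> \<le> 1 / (4 * real k)"
      proof -
        have "c ^ n \<le> c ^ N" using c n by (intro power_increasing) (auto simp: N_def)
        then have "real (c ^ n) * \<beta> \<le> real (c ^ N) * \<beta>" using \<beta> by (intro mult_right_mono) (simp_all only: of_nat_le_iff less_imp_le)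
        also have "\<dots> = 1 / (4 * real k)" using cN by (simp add: \<beta>_def)
        finally show ?thesis .
      qed
      moreover have "1 / (4 * real k) + 1 / (4 * real k) < 1 / real k" using k by (simp add: field_simps)
      ultimately show "1 - 1 / real k < prob ?U" by linarith
    qed
  qed
qed

section \<open>The Rokhlin metric in terms of labellings\<close>

lemma label_partition_in_partitions:
  assumes "f \<in> M \<rightarrow>\<^sub>M count_space (index_set m)"
  shows "label_partition M f \<in> partitions M m"
    and "enumerates (index_set m) (\<lambda>i. f -` {i} \<inter> space M) (label_partition M f)"
proof -
  have f: "f \<in> M \<rightarrow>\<^sub>M count_space UNIV" "f ` space M \<subseteq> index_set m"
    using measurable_count_space_UNIV[OF assms] measurable_space[OF assms] by auto
  have S: "{i \<in> index_set m. f -` {i} \<inter> space M \<noteq> {}} = f ` space M" using f(2) by auto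
  have bij: "bij_betw (\<lambda>i. f -` {i} \<inter> space M) (f ` space M) (label_partition M f)"
    unfolding bij_betw_def
  proof
    show "inj_on (\<lambda>i. f -` {i} \<inter> space M) (f ` space M)" by (auto simp: inj_on_def)
    show "(\<lambda>i. f -` {i} \<inter> space M) ` f ` space M = label_partition M f"
      by (auto simp: label_partition_def image_iff)
  qed
  then show "enumerates (index_set m) (\<lambda>i. f -` {i} \<inter> space M) (label_partition M f)"
    unfolding enumerates_def S .
  have "label_partition M f \<approx> f ` space M"
    using bij by (meson eqpoll_def eqpoll_sym)
  then have "label_partition M f \<lesssim> index_set m"
    using f(2) by (meson eqpoll_imp_lepoll lepoll_trans subset_imp_lepoll)
  moreover have "partition_on (space M) (label_partition M f)"
    by (auto simp: partition_on_def label_partition_def disjoint_def)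
  moreover have "label_partition M f \<subseteq> sets M"
    using measurable_sets[OF f(1)] by (auto simp: label_partition_def)
  ultimately show "label_partition M f \<in> partitions M m"
    by (simp add: partitions_def measurable_partition_def)
qed

text \<open>The label of a point is the index of the element containing it. It is unique because
  distinct elements are disjoint and an enumeration lists each of them once.\<close>

lemma enumeration_labels:
  assumes P: "P \<in> partitions M m" "enumerates (index_set m) e P"
  obtains f where "f \<in> M \<rightarrow>\<^sub>M count_space (index_set m)" "label_partition M f = P"
    "\<And>i. i \<in> index_set m \<Longrightarrow> e i = f -` {i} \<inter> space M"
proof -
  have "\<exists>i\<in>index_set m. x \<in> e i" if "x \<in> space M" for x
  proof -
    have "x \<in> \<Union>P"
      using P(1) that by (simp add: partitions_def measurable_partition_def partition_on_def)
    then obtain A where "A \<in> P" "x \<in> A" by blast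
    then show ?thesis using enumerates_obtain[OF P(2)] by metis
  qed
  then obtain f where f: "\<And>x. x \<in> space M \<Longrightarrow> f x \<in> index_set m \<and> x \<in> e (f x)" by metis
  have eM: "e i \<subseteq> space M" if "i \<in> index_set m" for i
    using enumerates_sets[OF P that] sets.sets_into_space by blast
  have e: "e i = f -` {i} \<inter> space M" if i: "i \<in> index_set m" for i
  proof (intro subset_antisym subsetI)
    fix x assume x: "x \<in> e i"
    then have xM: "x \<in> space M" using eM[OF i] by blast
    have "e i \<in> P" "e (f x) \<in> P" using enumerates_cases[OF P(2)] f[OF xM] x i by blast+
    then have "e i = e (f x)" using partitions_disjoint[OF P(1)] f[OF xM] x by blast
    then show "x \<in> f -` {i} \<inter> space M" using enumerates_inj[OF P(2) i, of "f x"] f[OF xM] x xM by auto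
  qed (use f in auto)
  have fm: "f \<in> M \<rightarrow>\<^sub>M count_space (index_set m)"
  proof (subst measurable_count_space_eq_countable)
    show "f \<in> space M \<rightarrow> index_set m \<and> (\<forall>a\<in>index_set m. f -` {a} \<inter> space M \<in> sets M)"
      using f enumerates_sets[OF P] e by auto
  qed simp
  have "e ` {i \<in> index_set m. e i \<noteq> {}} =
      (\<lambda>i. f -` {i} \<inter> space M) ` {i \<in> index_set m. f -` {i} \<inter> space M \<noteq> {}}"
    by (rule image_cong) (simp_all only: e mem_Collect_eq cong: conj_cong)
  then have "label_partition M f = P"
    using P(2) label_partition_in_partitions(2)[OF fm] unfolding enumerates_def bij_betw_def by simp
  then show thesis using that fm e by blast
qed

definition label_class :: "enat \<Rightarrow> ('a \<Rightarrow> nat) \<Rightarrow> 'a set set set" where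
  "label_class m f = partition_rel M m `` {label_partition M f}"

lemma label_class_in_space:
  assumes "f \<in> M \<rightarrow>\<^sub>M count_space (index_set m)"
  shows "label_class m f \<in> partition_space M m" "label_partition M f \<in> label_class m f"
  using label_partition_in_partitions(1)[OF assms] equiv_class_self[OF equiv_partition_rel]
  by (auto simp: label_class_def partition_space_def intro: quotientI)

lemma label_class_eq:
  assumes "C \<in> partition_space M m" "label_partition M f \<in> C"
  shows "label_class m f = C"
proof -
  obtain P where P: "C = partition_rel M m `` {P}"
    using assms(1) unfolding partition_space_def by (rule quotientE)
  then have "(P, label_partition M f) \<in> partition_rel M m" using assms(2) by blast
  then show ?thesis unfolding label_class_def P
    using equiv_class_eq[OF equiv_partition_rel] by blast
qed

text \<open>A point with \<open>f x \<noteq> g x\<close> lies in exactly two of the symmetric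
  differences, those of the indices \<open>f x\<close> and \<open>g x\<close>; hence the factor
  2.\<close>

lemma partition_dist_label_class_le:
  assumes f: "f \<in> M \<rightarrow>\<^sub>M count_space (index_set m)" and g: "g \<in> M \<rightarrow>\<^sub>M count_space (index_set m)"
  shows "partition_dist M m (label_class m f) (label_class m g) \<le> 2 * prob {x \<in> space M. f x \<noteq> g x}"
proof -
  have [measurable]: "f \<in> M \<rightarrow>\<^sub>M count_space UNIV" "g \<in> M \<rightarrow>\<^sub>M count_space UNIV"
    using measurable_count_space_UNIV[OF f] measurable_count_space_UNIV[OF g] .
  let ?F = "\<lambda>i. f -` {i} \<inter> space M" and ?G = "\<lambda>i. g -` {i} \<inter> space M"
  define E where "E = {x \<in> space M. f x \<noteq> g x}"
  have [measurable]: "E \<in> sets M" unfolding E_def by measurable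
  have split: "(\<Sum>\<^sub>\<infinity>i\<in>index_set m. emeasure M (u -` {i} \<inter> E)) \<le> emeasure M E"
    if [measurable]: "u \<in> M \<rightarrow>\<^sub>M count_space UNIV" for u :: "'a \<Rightarrow> nat"
  proof -
    have "u -` {i} \<inter> E = {x \<in> E. u x = i}" for i by auto
    moreover have "{x \<in> E. u x = i} \<in> sets M" for i
    proof -
      have "{x \<in> E. u x = i} = E \<inter> {x \<in> space M. u x = i}" by (auto simp: E_def)
      then show ?thesis by simp
    qed
    ultimately have S: "u -` {i} \<inter> E \<in> sets M" for i by simp
    have "(\<lambda>i. emeasure M (u -` {i} \<inter> E)) sums emeasure M (\<Union>i. u -` {i} \<inter> E)"
      using S by (intro sums_emeasure) (auto simp: disjoint_family_on_def)
    moreover have "(\<Union>i. u -` {i} \<inter> E) = E" by auto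
    ultimately have "(\<lambda>i. emeasure M (u -` {i} \<inter> E)) sums emeasure M E" by simp
    moreover have "(\<lambda>i. emeasure M (u -` {i} \<inter> E)) sums (\<Sum>\<^sub>\<infinity>i. emeasure M (u -` {i} \<inter> E))"
      by (intro has_sum_imp_sums has_sum_infsum) (simp add: nonneg_summable_on_complete)
    ultimately have "(\<Sum>\<^sub>\<infinity>i. emeasure M (u -` {i} \<inter> E)) = emeasure M E" using sums_unique2 by blast
    moreover have "(\<Sum>\<^sub>\<infinity>i\<in>index_set m. emeasure M (u -` {i} \<inter> E)) \<le> (\<Sum>\<^sub>\<infinity>i. emeasure M (u -` {i} \<inter> E))"
      by (intro infsum_mono_neutral) (auto simp: nonneg_summable_on_complete)
    ultimately show ?thesis by simp
  qed
  have FE: "u -` {i} \<inter> E \<in> sets M" if [measurable]: "u \<in> M \<rightarrow>\<^sub>M count_space UNIV" for u :: "'a \<Rightarrow> nat" and i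
  proof -
    have "u -` {i} \<inter> E = E \<inter> {x \<in> space M. u x = i}" by (auto simp: E_def)
    then show ?thesis by simp
  qed
  have "Inf (partition_costs m (label_class m f) (label_class m g)) \<le>
      (\<Sum>\<^sub>\<infinity>i\<in>index_set m. emeasure M (sym_diff (?F i) (?G i)))"
  proof (rule Inf_lower)
    show "(\<Sum>\<^sub>\<infinity>i\<in>index_set m. emeasure M (sym_diff (?F i) (?G i))) \<in>
        partition_costs m (label_class m f) (label_class m g)"
      unfolding partition_costs_def mem_Collect_eq
      using label_class_in_space(2)[OF f] label_class_in_space(2)[OF g]
        label_partition_in_partitions(2)[OF f] label_partition_in_partitions(2)[OF g]
      by (intro exI[of _ ?F] exI[of _ ?G] exI[of _ "label_partition M f"] exI[of _ "label_partition M g"] conjI refl)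
  qed
  also have "\<dots> \<le> (\<Sum>\<^sub>\<infinity>i\<in>index_set m. emeasure M (f -` {i} \<inter> E) + emeasure M (g -` {i} \<inter> E))"
  proof (rule infsum_mono)
    fix i
    have "sym_diff (?F i) (?G i) = (f -` {i} \<inter> E) \<union> (g -` {i} \<inter> E)" by (auto simp: E_def)
    then show "emeasure M (sym_diff (?F i) (?G i)) \<le> emeasure M (f -` {i} \<inter> E) + emeasure M (g -` {i} \<inter> E)"
      using emeasure_subadditive[OF FE FE] by simp
  qed (auto simp: nonneg_summable_on_complete)
  also have "\<dots> = (\<Sum>\<^sub>\<infinity>i\<in>index_set m. emeasure M (f -` {i} \<inter> E)) +
      (\<Sum>\<^sub>\<infinity>i\<in>index_set m. emeasure M (g -` {i} \<inter> E))"
    by (simp add: infsum_add nonneg_summable_on_complete)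
  also have "\<dots> \<le> emeasure M E + emeasure M E" by (intro add_mono split) measurable
  also have "\<dots> = ennreal (2 * prob E)" by (simp add: emeasure_eq_measure flip: ennreal_plus)
  finally show ?thesis unfolding partition_dist_costs E_def
    by (metis enn2real_ennreal enn2real_mono ennreal_less_top measure_nonneg mult_nonneg_nonneg zero_le_numeral)
qed

text \<open>Keeps the labelling \<open>f\<close> and reaches a prescribed representative
  \<open>Q\<close>. An almost optimal pair of enumerations may belong to other representatives of
  both classes; two uses of \<open>triangle_aux\<close> carry it over to \<open>f\<close> and
  \<open>Q\<close> at small cost.\<close>

lemma partition_dist_less_labels:
  assumes f: "f \<in> M \<rightarrow>\<^sub>M count_space (index_set m)"
    and D: "D \<in> partition_space M m" "Q \<in> D"
    and dist: "partition_dist M m (label_class m f) D < \<epsilon>"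
  obtains g where "g \<in> M \<rightarrow>\<^sub>M count_space (index_set m)" "label_partition M g = Q"
    "prob {x \<in> space M. f x \<noteq> g x} < \<epsilon>"
proof -
  let ?F = "\<lambda>i. f -` {i} \<inter> space M" and ?I = "index_set m"
  let ?C = "label_class m f"
  note C = label_class_in_space[OF f]
  note F = label_partition_in_partitions[OF f]
  have fin: "Inf (partition_costs m ?C D) < top" by (rule Inf_partition_costs_finite[OF C(1) D(1)])
  have "0 < \<epsilon>" using dist by (metis enn2real_nonneg order_le_less_trans partition_dist_costs)
  have "Inf (partition_costs m ?C D) < ennreal \<epsilon>"
    using dist fin \<open>0 < \<epsilon>\<close> unfolding partition_dist_costs by (metis ennreal_enn2real ennreal_less_iff enn2real_nonneg)
  then obtain c where c: "c \<in> partition_costs m ?C D" "c < ennreal \<epsilon>" unfolding Inf_less_iff by blast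
  then obtain e' f' P' Q' where 1: "P' \<in> ?C" "Q' \<in> D" "enumerates ?I e' P'" "enumerates ?I f' Q'"
      "c = (\<Sum>\<^sub>\<infinity>i\<in>?I. emeasure M (sym_diff (e' i) (f' i)))"
    by (auto simp: partition_costs_def)
  \<comment> \<open>Each of the two transfers costs \<open>2 * \<delta>\<close>; the fifth part
    leaves a margin for the strict inequality.\<close>
  define \<delta> where "\<delta> = (\<epsilon> - enn2real c) / 5"
  have c_fin: "c = ennreal (enn2real c)" using c(2) by (metis ennreal_enn2real ennreal_less_top order_less_trans)
  have c\<epsilon>: "enn2real c < \<epsilon>" using c(2) c_fin by (metis ennreal_less_iff enn2real_nonneg)
  then have \<delta>: "0 < \<delta>" by (simp add: \<delta>_def)
  have QP: "Q \<in> partitions M m" using partition_space_subset[OF D] .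
  have Q'P: "Q' \<in> partitions M m" using partition_space_subset[OF D(1) 1(2)] .
  obtain q where q: "enumerates ?I q Q"
    using enumerates_exists[of Q ?I] QP
    by (auto simp: partitions_def measurable_partition_def partition_on_def)
  \<comment> \<open>The first transfer replaces \<open>P'\<close> by the partition of
    \<open>f\<close>, the second one replaces \<open>Q'\<close> by \<open>Q\<close>. In each, one of
    the sums compares an enumeration with itself and vanishes.\<close>
  obtain g1 where g1: "enumerates ?I g1 Q'"
    "(\<Sum>\<^sub>\<infinity>i\<in>?I. emeasure M (sym_diff (?F i) (g1 i))) \<le>
      (\<Sum>\<^sub>\<infinity>i\<in>?I. emeasure M (sym_diff (?F i) (?F i))) + c + (ennreal \<delta> + ennreal \<delta>)"
    using triangle_aux[OF F F partition_space_rel[OF C(1) C(2) 1(1)] 1(3) Q'P 1(4), of "ennreal \<delta>"] \<delta> 1(5)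
    by auto
  obtain g2 where g2: "enumerates ?I g2 Q"
    "(\<Sum>\<^sub>\<infinity>i\<in>?I. emeasure M (sym_diff (?F i) (g2 i))) \<le>
      (\<Sum>\<^sub>\<infinity>i\<in>?I. emeasure M (sym_diff (?F i) (g1 i))) +
      (\<Sum>\<^sub>\<infinity>i\<in>?I. emeasure M (sym_diff (q i) (q i))) + (ennreal \<delta> + ennreal \<delta>)"
    using triangle_aux[OF F Q'P g1(1) partition_space_rel[OF D(1) 1(2) D(2)] q QP q, of "ennreal \<delta>"] \<delta>
    by auto
  obtain g where g: "g \<in> M \<rightarrow>\<^sub>M count_space ?I" "label_partition M g = Q"
    "\<And>i. i \<in> ?I \<Longrightarrow> g2 i = g -` {i} \<inter> space M"
    using enumeration_labels[OF QP g2(1)] by blast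
  have [measurable]: "f \<in> M \<rightarrow>\<^sub>M count_space UNIV" "g \<in> M \<rightarrow>\<^sub>M count_space UNIV"
    using measurable_count_space_UNIV[OF f] measurable_count_space_UNIV[OF g(1)] .
  define E where "E = {x \<in> space M. f x \<noteq> g x}"
  define S where "S i = (if i \<in> ?I then sym_diff (?F i) (g2 i) else {})" for i
  have Ss: "S i \<in> sets M" for i using g(3) by (auto simp: S_def)
  have "E \<subseteq> (\<Union>i. S i)"
  proof
    fix x assume x: "x \<in> E"
    then have "f x \<in> ?I" using measurable_space[OF f, of x] by (simp add: E_def)
    then have "x \<in> S (f x)" using x g(3) by (auto simp: S_def E_def)
    then show "x \<in> (\<Union>i. S i)" by blast
  qed
  then have "emeasure M E \<le> emeasure M (\<Union>i. S i)" using Ss by (intro emeasure_mono) auto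
  also have "\<dots> \<le> (\<Sum>i. emeasure M (S i))" using Ss by (intro emeasure_subadditive_countably) auto
  also have "\<dots> = (\<Sum>\<^sub>\<infinity>i. emeasure M (S i))"
    by (intro sums_unique[symmetric] has_sum_imp_sums has_sum_infsum) (simp add: nonneg_summable_on_complete)
  also have "\<dots> = (\<Sum>\<^sub>\<infinity>i\<in>?I. emeasure M (sym_diff (?F i) (g2 i)))"
    by (intro infsum_cong_neutral) (auto simp: S_def)
  also have "\<dots> \<le> c + (ennreal \<delta> + ennreal \<delta>) + (ennreal \<delta> + ennreal \<delta>)"
    using g1(2) g2(2) by (auto intro: order_trans add_right_mono)
  also have "\<dots> = ennreal (enn2real c + (\<delta> + \<delta>) + (\<delta> + \<delta>))"
    using \<delta> by (subst c_fin) (simp flip: ennreal_plus)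
  finally have "ennreal (prob E) \<le> ennreal (enn2real c + (\<delta> + \<delta>) + (\<delta> + \<delta>))"
    by (simp only: emeasure_eq_measure)
  then have "prob E \<le> enn2real c + (\<delta> + \<delta>) + (\<delta> + \<delta>)"
    using \<delta> by (subst (asm) ennreal_le_iff) auto
  also have "\<dots> < \<epsilon>" using c\<epsilon> by (simp add: \<delta>_def field_simps)
  finally show thesis using that g unfolding E_def by blast
qed

section \<open>Completeness of the space of partitions\<close>

text \<open>Along a fast subsequence one chooses labellings successively, each close to the previous
  one. The probabilities of a change are summable, so the labels converge pointwise off sets of
  small probability, and the limit labelling gives the limit class.\<close>

lemma mcomplete_partitions: "Metric_space.mcomplete (partition_space M m) (partition_dist M m)"
proof -
  interpret P: Metric_space "partition_space M m" "partition_dist M m" by (rule Metric_space_partitions)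
  let ?I = "index_set m"
  show ?thesis unfolding P.mcomplete_def
  proof (intro allI impI)
    fix \<sigma> assume cau: "P.MCauchy \<sigma>"
    then have \<sigma>: "\<sigma> n \<in> partition_space M m" for n by (auto simp: P.MCauchy_def)
    have "\<exists>N. \<forall>n n'. N \<le> n \<longrightarrow> N \<le> n' \<longrightarrow> partition_dist M m (\<sigma> n) (\<sigma> n') < (1/2)^k" for k :: nat
      using cau by (simp add: P.MCauchy_def)
    then obtain K where K: "\<And>k n n'. K k \<le> n \<Longrightarrow> K k \<le> n' \<Longrightarrow> partition_dist M m (\<sigma> n) (\<sigma> n') < (1/2)^k"
      by metis
    \<comment> \<open>Strictly increasing and beyond \<open>K j\<close> for all \<open>j\<close> up
      to \<open>k\<close>.\<close>
    define r where "r k = (\<Sum>j\<le>k. K j) + k" for k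
    have mono: "strict_mono r" by (auto simp: strict_mono_Suc_iff r_def)
    have Kr: "K k \<le> r j" if "k \<le> j" for k j
    proof -
      have "K k \<le> (\<Sum>j\<le>j. K j)" using that by (intro member_le_sum) auto
      then show ?thesis by (simp add: r_def)
    qed
    have step: "partition_dist M m (\<sigma> (r k)) (\<sigma> (r (Suc k))) < (1/2)^k" for k by (intro K Kr) auto
    have "\<exists>f. \<forall>k. (f k \<in> M \<rightarrow>\<^sub>M count_space ?I \<and> label_partition M (f k) \<in> \<sigma> (r k)) \<and>
        prob {x \<in> space M. f k x \<noteq> f (Suc k) x} < (1/2)^k"
    proof (rule dependent_nat_choice)
      obtain Q e where Q: "Q \<in> \<sigma> (r 0)" "Q \<in> partitions M m" "enumerates ?I e Q"
        using partition_space_obtain[OF \<sigma>] by metis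
      then show "\<exists>f. f \<in> M \<rightarrow>\<^sub>M count_space ?I \<and> label_partition M f \<in> \<sigma> (r 0)"
        using enumeration_labels[OF Q(2,3)] by metis
    next
      fix f k assume f: "f \<in> M \<rightarrow>\<^sub>M count_space ?I \<and> label_partition M f \<in> \<sigma> (r k)"
      have "label_class m f = \<sigma> (r k)" using label_class_eq[OF \<sigma>] f by blast
      then have d: "partition_dist M m (label_class m f) (\<sigma> (r (Suc k))) < (1/2)^k" using step by simp
      obtain Q where Q: "Q \<in> \<sigma> (r (Suc k))" using partition_space_obtain[OF \<sigma>] by metis
      obtain g where "g \<in> M \<rightarrow>\<^sub>M count_space ?I" "label_partition M g = Q"
        "prob {x \<in> space M. f x \<noteq> g x} < (1/2)^k"
        using partition_dist_less_labels[OF conjunct1[OF f] \<sigma> Q d] .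
      then show "\<exists>g. (g \<in> M \<rightarrow>\<^sub>M count_space ?I \<and> label_partition M g \<in> \<sigma> (r (Suc k))) \<and>
          prob {x \<in> space M. f x \<noteq> g x} < (1/2)^k" using Q by blast
    qed
    then obtain f where f: "\<And>k. f k \<in> M \<rightarrow>\<^sub>M count_space ?I" "\<And>k. label_partition M (f k) \<in> \<sigma> (r k)"
      "\<And>k. prob {x \<in> space M. f k x \<noteq> f (Suc k) x} < (1/2)^k" by blast
    have fU: "f k \<in> M \<rightarrow>\<^sub>M count_space UNIV" for k by (rule measurable_count_space_UNIV[OF f(1)])
    have eqM: "Measurable.pred M (\<lambda>x. f j x = f k x)" for j k by (rule pred_nat_eq[OF fU fU])
    define B where "B k = {x \<in> space M. f k x \<noteq> f (Suc k) x}" for k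
    have [measurable]: "B k \<in> sets M" for k
      using sets.sets_Collect_neg[OF eqM[of k "Suc k", THEN predE]] by (simp add: B_def)
    \<comment> \<open>Where the labels never stabilize, \<open>l x\<close> is arbitrary. Then
      \<open>g x\<close> is still an admissible label, and such points lie in every tail union of
      the sets \<open>B j\<close>.\<close>
    define l where "l x = (LEAST k. \<forall>j\<in>{k..}. f j x = f k x)" for x
    define g where "g x = f (l x) x" for x
    have g_eq: "g x = f k x" if "\<forall>j\<in>{k..}. f j x = f k x" for x k
    proof -
      have "\<forall>j\<in>{l x..}. f j x = f (l x) x" unfolding l_def by (rule LeastI[of "\<lambda>k. \<forall>j\<in>{k..}. f j x = f k x", OF that])
      moreover have "l x \<le> k" unfolding l_def by (rule Least_le[of "\<lambda>k. \<forall>j\<in>{k..}. f j x = f k x", OF that])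
      ultimately show ?thesis unfolding g_def by (metis atLeast_iff)
    qed
    have "l \<in> M \<rightarrow>\<^sub>M count_space UNIV"
      unfolding l_def[abs_def] by (intro measurable_Least pred_intros_countable_bounded eqM)
    then have gU: "g \<in> M \<rightarrow>\<^sub>M count_space UNIV"
      unfolding g_def[abs_def] by (rule measurable_compose_countable[OF fU])
    note [measurable] = gU
    have gI: "g \<in> M \<rightarrow>\<^sub>M count_space ?I"
    proof (rule measurable_count_space_subset[OF gU])
      show "g ` space M \<subseteq> ?I" using measurable_space[OF f(1)] by (auto simp: g_def)
    qed
    have tail: "prob {x \<in> space M. f k x \<noteq> g x} \<le> 2 * (1/2)^k" for k
    proof -
      have geo: "(\<lambda>j. (1/2 :: real)^(j + k)) sums (2 * (1/2)^k)"
        using sums_mult2[OF geometric_sums[of "1/2 :: real"], of "(1/2)^k"] by (simp add: power_add)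
      have le: "prob (B (j + k)) \<le> (1/2)^(j + k)" for j using f(3)[of "j + k"] by (simp add: B_def less_imp_le)
      have sm: "summable (\<lambda>j. prob (B (j + k)))"
        by (rule summable_comparison_test'[OF sums_summable[OF geo]]) (use le in auto)
      have "prob {x \<in> space M. f k x \<noteq> g x} \<le> prob (\<Union>j. B (j + k))"
      proof (rule finite_measure_mono_AE)
        show "AE x in M. x \<in> {x \<in> space M. f k x \<noteq> g x} \<longrightarrow> x \<in> (\<Union>j. B (j + k))"
        proof (rule AE_I2, intro impI)
          fix x assume x: "x \<in> {x \<in> space M. f k x \<noteq> g x}"
          show "x \<in> (\<Union>j. B (j + k))"
          proof (rule ccontr)
            assume "\<not> ?thesis"
            then have *: "f (j + k) x = f (Suc (j + k)) x" for j using x by (auto simp: B_def)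
            have "f (j + k) x = f k x" for j
            proof (induction j)
              case (Suc j)
              then show ?case using *[of j] by simp
            qed simp
            then have "\<forall>j\<in>{k..}. f j x = f k x" by (metis atLeast_iff le_add_diff_inverse2)
            then have "g x = f k x" by (rule g_eq)
            then show False using x by simp
          qed
        qed
      qed auto
      also have "\<dots> \<le> (\<Sum>j. prob (B (j + k)))"
        using sm by (intro finite_measure_subadditive_countably) auto
      also have "\<dots> \<le> 2 * (1/2)^k"
        using suminf_le[OF le sm sums_summable[OF geo]] sums_unique[OF geo] by simp
      finally show ?thesis .
    qed
    have "limitin P.mtopology (\<sigma> \<circ> r) (label_class m g) sequentially"
      unfolding P.limitin_metric
    proof (intro conjI allI impI)
      show "label_class m g \<in> partition_space M m" by (rule label_class_in_space[OF gI])
      fix \<epsilon> :: real assume "0 < \<epsilon>"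
      have "(\<lambda>k. 4 * (1/2 :: real)^k) \<longlonglongrightarrow> 0" by real_asymp
      then have "eventually (\<lambda>k. 4 * (1/2 :: real)^k < \<epsilon>) sequentially"
        using \<open>0 < \<epsilon>\<close> by (rule order_tendstoD)
      then show "eventually (\<lambda>k. (\<sigma> \<circ> r) k \<in> partition_space M m \<and>
          partition_dist M m ((\<sigma> \<circ> r) k) (label_class m g) < \<epsilon>) sequentially"
      proof eventually_elim
        case (elim k)
        have "partition_dist M m (label_class m (f k)) (label_class m g) \<le> 2 * prob {x \<in> space M. f k x \<noteq> g x}"
          by (rule partition_dist_label_class_le[OF f(1) gI])
        also have "\<dots> \<le> 4 * (1/2)^k" using tail[of k] by simp
        also note elim
        finally show ?case using label_class_eq[OF \<sigma> f(2)] \<sigma> by simp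
      qed
    qed
    then show "\<exists>C. limitin P.mtopology \<sigma> C sequentially"
      using P.MCauchy_convergent_subsequence[OF cau mono] by blast
  qed
qed

section \<open>From windows of lengths to strong attracting\<close>

text \<open>A length \<open>n\<close> in the union of the windows uses the largest index
  \<open>\<kappa> n\<close> whose window contains it. Each window is finite, so
  \<open>\<kappa> n\<close> tends to infinity along the union. As hitting distributions increase in
  time, the bound at time \<open>\<kappa> n\<close> finally controls every fixed
  \<open>t\<close>.\<close>

lemma strong_attracting_if_windows:
  assumes T: "T \<in> M \<rightarrow>\<^sub>M M" and P: "P \<subseteq> sets M"
    and win: "\<And>k. attracting_window M T P (Suc k)"
  shows "strong_attracting M T P"
proof -
  define good where "good k n = {B \<in> blocks M T P n. 0 < prob B \<and> hitting_distr M T B (real k) < 1 / real k}" for k n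
  have "\<exists>n0. \<forall>k. k \<ge> 1 \<longrightarrow> n0 k \<ge> k \<and> (\<forall>n\<in>{n0 k..k * n0 k}. 1 - 1 / real k < prob (\<Union>(good k n)))"
  proof (rule choice, intro allI)
    fix k show "\<exists>n0. k \<ge> 1 \<longrightarrow> n0 \<ge> k \<and> (\<forall>n\<in>{n0..k * n0}. 1 - 1 / real k < prob (\<Union>(good k n)))"
      using win[of "k - 1"] by (cases k) (auto simp: attracting_window_def good_def)
  qed
  then obtain n0 where n0: "\<And>k. k \<ge> 1 \<Longrightarrow> n0 k \<ge> k"
    "\<And>k n. k \<ge> 1 \<Longrightarrow> n \<in> {n0 k..k * n0 k} \<Longrightarrow> 1 - 1 / real k < prob (\<Union>(good k n))" by blast
  define N where "N = (\<Union>k\<in>{1..}. {n0 k..k * n0 k})"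
  define S where "S n = {k. k \<ge> 1 \<and> n \<in> {n0 k..k * n0 k}}" for n
  define \<kappa> where "\<kappa> n = Max (S n)" for n
  have fin: "finite (S n)" for n
  proof (rule finite_subset)
    show "S n \<subseteq> {..n}" using n0(1) by (force simp: S_def)
  qed simp
  have ne: "S n \<noteq> {}" if "n \<in> N" for n using that by (auto simp: N_def S_def)
  have \<kappa>S: "\<kappa> n \<in> S n" if "n \<in> N" for n using Max_in[OF fin ne[OF that]] by (simp add: \<kappa>_def)
  have \<kappa>: "\<kappa> n \<ge> 1" "1 - 1 / real (\<kappa> n) < prob (\<Union>(good (\<kappa> n) n))" if "n \<in> N" for n
    using \<kappa>S[OF that] n0(2)[of "\<kappa> n" n] by (auto simp: S_def)
  have \<kappa>_large: "eventually (\<lambda>n. n \<in> N \<longrightarrow> K \<le> \<kappa> n) sequentially" for K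
    unfolding eventually_sequentially
  proof (intro exI allI impI)
    \<comment> \<open>The sum exceeds the right end of each window of index at most
      \<open>K\<close>, or equals it.\<close>
    fix n assume n: "Suc (\<Sum>k\<le>K. k * n0 k) \<le> n" "n \<in> N"
    show "K \<le> \<kappa> n"
    proof (rule ccontr)
      assume neg: "\<not> ?thesis"
      have "n \<le> \<kappa> n * n0 (\<kappa> n)" using \<kappa>S[OF n(2)] by (simp add: S_def)
      also have "\<dots> \<le> (\<Sum>k\<le>K. k * n0 k)" using neg by (intro member_le_sum) auto
      finally show False using n by simp
    qed
  qed
  let ?F = "inf sequentially (principal N)"
  have F_iff: "eventually Q ?F \<longleftrightarrow> eventually (\<lambda>n. n \<in> N \<longrightarrow> Q n) sequentially" for Q
    by (simp add: eventually_inf_principal)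
  have lim: "((\<lambda>n. 1 / real (\<kappa> n)) \<longlongrightarrow> 0) ?F"
  proof (rule tendstoI)
    fix e :: real assume e: "e > 0"
    obtain K where K: "1 / e < real K" using reals_Archimedean2 by blast
    show "eventually (\<lambda>n. dist (1 / real (\<kappa> n)) 0 < e) ?F" unfolding F_iff
      using \<kappa>_large[of K]
    proof eventually_elim
      case (elim n)
      show ?case
      proof
        assume n: "n \<in> N"
        then have "1 / e < real (\<kappa> n)" using elim K by linarith
        then show "dist (1 / real (\<kappa> n)) 0 < e" using e \<kappa>(1)[OF n] by (simp add: field_simps)
      qed
    qed
  qed
  show ?thesis unfolding strong_attracting_def
  proof (intro exI[of _ N] exI[of _ "\<lambda>n. good (\<kappa> n) n"] conjI ballI allI impI)
    show "N \<subseteq> {1..}" using n0(1) by (force simp: N_def)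
  next
    let ?d = "\<lambda>n. ereal (real (card (N \<inter> {1..n})) / real n)"
    show "upper_density N = 1" unfolding upper_density_def
    proof (rule antisym)
      have "?d n \<le> 1" for n
      proof -
        have "card (N \<inter> {1..n}) \<le> card {1..n}" by (intro card_mono) auto
        then show ?thesis by (cases "n = 0") auto
      qed
      then show "limsup ?d \<le> 1" by (intro Limsup_bounded) auto
    next
      show "1 \<le> limsup ?d"
      proof (rule ccontr)
        assume "\<not> ?thesis"
        then obtain c :: real where c: "limsup ?d < ereal c" "c < 1"
          using ereal_dense2[of "limsup ?d" 1] by (auto simp: not_le)
        then have "eventually (\<lambda>n. ?d n < ereal c) sequentially" by (intro Limsup_lessD)
        then obtain n1 where n1: "\<And>n. n \<ge> n1 \<Longrightarrow> ?d n < ereal c" by (auto simp: eventually_sequentially)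
        obtain K where K: "1 / (1 - c) < real K" using reals_Archimedean2 by blast
        \<comment> \<open>An index above \<open>1 / (1 - c)\<close> makes the window alone fill more
          than the proportion \<open>c\<close>; being at least \<open>n1\<close>, it also puts the
          right end past \<open>n1\<close>.\<close>
        define k where "k = max (max K n1) 1"
        have k: "k \<ge> 1" "k \<ge> n1" "real K \<le> real k" by (auto simp: k_def)
        have nk: "n0 k \<ge> k" using n0(1) k by blast
        have "{n0 k..k * n0 k} \<subseteq> N \<inter> {1..k * n0 k}" using k nk by (auto simp: N_def)
        then have "card {n0 k..k * n0 k} \<le> card (N \<inter> {1..k * n0 k})" by (intro card_mono) auto
        then have "k * n0 k \<le> card (N \<inter> {1..k * n0 k}) + n0 k" unfolding card_atLeastAtMost by linarith
        then have "real (k * n0 k) \<le> real (card (N \<inter> {1..k * n0 k}) + n0 k)" by (simp only: of_nat_le_iff)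
        then have "real (k * n0 k) - real (n0 k) \<le> real (card (N \<inter> {1..k * n0 k}))" by linarith
        moreover have "c * real (k * n0 k) < real (k * n0 k) - real (n0 k)"
        proof -
          have "1 < (1 - c) * real K" using K c(2) by (simp add: field_simps)
          also have "\<dots> \<le> (1 - c) * real k" using k(3) c(2) by (intro mult_left_mono) auto
          finally have "1 < (1 - c) * real k" .
          then have "1 * real (n0 k) < (1 - c) * real k * real (n0 k)"
            using k nk by (intro mult_strict_right_mono) auto
          then show ?thesis by (simp add: algebra_simps)
        qed
        ultimately have "c * real (k * n0 k) < real (card (N \<inter> {1..k * n0 k}))" by linarith
        moreover have "0 < real (k * n0 k)" using k nk by simp
        ultimately have "c < real (card (N \<inter> {1..k * n0 k})) / real (k * n0 k)"
          by (simp only: pos_less_divide_eq)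
        moreover have "n1 \<le> k * n0 k" using k nk by (metis le_trans mult_le_mono mult.right_neutral)
        ultimately show False using n1[of "k * n0 k"] by simp
      qed
    qed
  next
    fix n assume n: "n \<in> N"
    \<comment> \<open>Strictness matters here: for \<open>\<kappa> n = 1\<close> the lower bound is
      0, and only a strict inequality excludes the empty family.\<close>
    show "good (\<kappa> n) n \<noteq> {}"
    proof
      assume "good (\<kappa> n) n = {}"
      then show False using \<kappa>[OF n] by (simp add: field_simps)
    qed
    show "good (\<kappa> n) n \<subseteq> {B \<in> blocks M T P n. 0 < prob B}" by (auto simp: good_def)
  next
    have "((\<lambda>n. 1 - 1 / real (\<kappa> n)) \<longlongrightarrow> 1) ?F"
      using tendsto_diff[OF tendsto_const lim, of 1] by simp
    then show "((\<lambda>n. prob (\<Union>(good (\<kappa> n) n))) \<longlongrightarrow> 1) ?F"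
      by (rule tendsto_sandwich[OF _ _ _ tendsto_const, rotated 2])
        (auto simp: F_iff intro!: always_eventually less_imp_le \<kappa>)
  next
    fix B t assume B: "\<forall>n\<in>N. B n \<in> good (\<kappa> n) n" and t: "(0 :: real) \<le> t"
    obtain K where K: "t < real K" using reals_Archimedean2 by blast
    have "eventually (\<lambda>n. hitting_distr M T (B n) t \<le> 1 / real (\<kappa> n)) ?F" unfolding F_iff
      using \<kappa>_large[of K]
    proof eventually_elim
      case (elim n)
      show ?case
      proof
        assume n: "n \<in> N"
        then have b: "B n \<in> blocks M T P n" "0 < prob (B n)"
          "hitting_distr M T (B n) (real (\<kappa> n)) < 1 / real (\<kappa> n)" using B by (auto simp: good_def)
        have "hitting_distr M T (B n) t \<le> hitting_distr M T (B n) (real (\<kappa> n))"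
          using elim n K by (intro hitting_distr_mono T b blocks_sets[OF T P b(1)]) auto
        then show "hitting_distr M T (B n) t \<le> 1 / real (\<kappa> n)" using b(3) by linarith
      qed
    qed
    then show "((\<lambda>n. hitting_distr M T (B n) t) \<longlongrightarrow> 0) ?F"
      by (rule tendsto_sandwich[OF _ _ tendsto_const lim, rotated]) (auto simp: hitting_distr_def)
  qed
qed

end

section \<open>The Baire category argument\<close>

theorem theorem2:
  fixes M :: "'a measure" and T :: "'a \<Rightarrow> 'a" and m :: enat
  assumes "standard_prob_space M"
    and "ergodic M T"
    and "KS_entropy M T > 0"
    and "2 \<le> m"
  shows "\<exists>\<G>. gdelta_in (partition_topology M m) \<G> \<and>
     partition_topology M m closure_of \<G> = partition_space M m \<and>
     (\<forall>C\<in>\<G>. \<forall>P\<in>C. strong_attracting M T P)"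
proof -
  interpret prob_space M using assms(1) by (simp add: standard_prob_space_def)
  interpret P: Metric_space "partition_space M m" "partition_dist M m" by (rule Metric_space_partitions)
  have T: "T \<in> M \<rightarrow>\<^sub>M M" using assms(2) by (simp add: ergodic_def measure_preserving_def)
  have "enat 1 < m" using assms(4) by (metis enat_ord_simps(2) less_le_trans one_less_numeral_iff numeral_eq_enat semiring_norm(76) one_enat_def)
  then have I: "0 \<in> index_set m" "1 \<in> index_set m"
    using order.strict_trans[of "enat 0" "enat 1" m] by (auto simp: index_set_def)
  have small: "\<exists>A\<in>sets M. 0 < prob A \<and> prob A < \<eta>" if "\<eta> > 0" for \<eta>
    using small_set_if_KS_entropy_pos[OF T assms(3) that] .
  \<comment> \<open>All representatives of a class are required to have the window. Passing to the
    interior supplies openness; density holds because marked labellings are arbitrarily near to any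
    class and have a whole ball inside \<open>W k\<close>.\<close>
  define W where "W k = {C \<in> partition_space M m. \<forall>P\<in>C. attracting_window M T P (Suc k)}" for k
  define U where "U k = P.mtopology interior_of W k" for k
  have dense: "P.mtopology closure_of U k = partition_space M m" for k
  proof (rule antisym)
    show "P.mtopology closure_of U k \<subseteq> partition_space M m"
      using closure_of_subset_topspace[of P.mtopology] by simp
    show "partition_space M m \<subseteq> P.mtopology closure_of U k"
    proof
      fix C assume C: "C \<in> partition_space M m"
      obtain P e where P: "P \<in> C" "P \<in> partitions M m" "enumerates (index_set m) e P"
        using partition_space_obtain[OF C] .
      obtain f where f: "f \<in> M \<rightarrow>\<^sub>M count_space (index_set m)" "label_partition M f = P"
        using enumeration_labels[OF P(2,3)] by metis
      have Cf: "label_class m f = C" using label_class_eq[OF C] f P by simp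
      show "C \<in> P.mtopology closure_of U k" unfolding P.metric_closure_of
      proof (intro CollectI conjI allI impI C)
        fix r :: real assume r: "0 < r"
        have k1: "1 \<le> Suc k" by simp
        \<comment> \<open>Disagreement below \<open>r / 2\<close>, since the distance may be twice
          as large.\<close>
        obtain f' \<delta> where f': "f' \<in> M \<rightarrow>\<^sub>M count_space (index_set m)"
          "prob {x \<in> space M. f' x \<noteq> f x} < r / 2" "0 < \<delta>"
          "\<And>g. g \<in> M \<rightarrow>\<^sub>M count_space UNIV \<Longrightarrow> prob {x \<in> space M. g x \<noteq> f' x} < \<delta> \<Longrightarrow>
            attracting_window M T (label_partition M g) (Suc k)"
          using attracting_window_perturbation[OF assms(2) small f(1) I half_gt_zero[OF r] k1] by blast
        let ?D = "label_class m f'"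
        have D: "?D \<in> partition_space M m" by (rule label_class_in_space[OF f'(1)])
        have "partition_dist M m C ?D \<le> 2 * prob {x \<in> space M. f x \<noteq> f' x}"
          using partition_dist_label_class_le[OF f(1) f'(1)] Cf by simp
        also have "\<dots> < r" using f'(2) by (simp add: eq_commute)
        finally have near: "?D \<in> P.mball C r" using C D by simp
        have "P.mball ?D \<delta> \<subseteq> W k"
        proof
          fix E assume "E \<in> P.mball ?D \<delta>"
          then have E: "E \<in> partition_space M m" "partition_dist M m ?D E < \<delta>" by auto
          \<comment> \<open>The representative \<open>Q\<close> is arbitrary, so it matters that
            \<open>g\<close> labels \<open>Q\<close> itself and not merely a partition equal to it
            modulo null sets.\<close>
          have "attracting_window M T Q (Suc k)" if Q: "Q \<in> E" for Q
          proof -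
            obtain g where g: "g \<in> M \<rightarrow>\<^sub>M count_space (index_set m)" "label_partition M g = Q"
              "prob {x \<in> space M. f' x \<noteq> g x} < \<delta>"
              using partition_dist_less_labels[OF f'(1) E(1) Q E(2)] .
            have "prob {x \<in> space M. g x \<noteq> f' x} < \<delta>" using g(3) by (simp add: eq_commute)
            then show ?thesis using f'(4)[OF measurable_count_space_UNIV[OF g(1)]] g(2) by simp
          qed
          then show "E \<in> W k" using E by (simp add: W_def)
        qed
        moreover have "?D \<in> P.mball ?D \<delta>" using D f'(3) by simp
        ultimately have "?D \<in> U k" unfolding U_def interior_of_def by (auto intro!: exI[of _ "P.mball ?D \<delta>"])
        then show "\<exists>y\<in>U k. y \<in> P.mball C r" using near by blast
      qed
    qed
  qed
  have U_open: "openin P.mtopology (U k)" for k by (simp add: U_def)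
  show ?thesis
  proof (intro exI[of _ "\<Inter>(range U)"] conjI ballI)
    show "gdelta_in P.mtopology (\<Inter>(range U))"
      by (intro gdelta_in_Inter) (auto intro: open_imp_gdelta_in U_open)
    show "P.mtopology closure_of \<Inter>(range U) = partition_space M m"
      by (intro P.metric_Baire_category mcomplete_partitions) (auto simp: U_open dense)
    fix C P assume CP: "C \<in> \<Inter>(range U)" "P \<in> C"
    have CW: "C \<in> W k" for k using CP(1) interior_of_subset[of P.mtopology "W k"] by (auto simp: U_def)
    then have "C \<in> partition_space M m" by (simp add: W_def)
    then have "P \<subseteq> sets M" using partition_space_subset CP(2) partitions_sets by blast
    then show "strong_attracting M T P"
      using CW CP(2) by (intro strong_attracting_if_windows[OF T]) (auto simp: W_def)
  qed
qed

end
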